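(* Let $M$ be an affine algebraic monoid with zero element $0\in M$ and unit group $G=G(M)$, let $\lambda$ be a non-trivial polynomial character of $M$, and let $\Omega$ be an $\Omega$-process on $\Bbbk[M]$ associated to $\lambda$. Let $V$ be a polynomial $M$-module with comodule structure $\chi:V\to V\otimes\Bbbk[M]$, $\chi(v)=\sum v_0\otimes v_1$, and for nonnegative integers $r,s$ consider the map $I_{r,s}:V\to V$, $$I_{r,s}(v)=\sum v_0\,\Omega^r(\lambda^s v_1)(0).$$ Then: (1) The map $I_{r,s}$ is a morphism of $M$-modules with respect to the original action on $V$ twisted by $\lambda^s$; that is, $(\lambda^s\chi)\circ I_{r,s}=(I_{r,s}\otimes\operatorname{id})\circ(\lambda^s\chi)$. (2) For all $v\in V$, $\lambda^s\chi\bigl(I_{r,s}(v)\bigr)=\lambda^r\bigl(I_{r,s}(v)\otimes 1\bigr)$. (3) Assume that $V$ is a polynomial $G$-module with structure $\theta:V\to V\otimes\Bbbk[G]$, and consider it as a polynomial $M$-module with structure $\chi:V\to V\otimes\Bbbk[M]$ such that $\theta=(\operatorname{id}\otimes\pi)\chi$. If $I_{r,s}$ is the map above (formed with $\chi$), then for all $v\in V$, $I_{r,s}(v)$ is a semi-invariant for the action of $G$ on $V$, of weight $\lambda^{r-s}$, i.e. $g\cdot I_{r,s}(v)=\lambda(g)^{r-s}I_{r,s}(v)$ for all $g\in G$.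
   Context: $\Bbbk$ is an algebraically closed field of characteristic zero. An affine (= linear) algebraic monoid $M$ is an irreducible affine normal algebraic variety over $\Bbbk$ with an associative product $M\times M\to M$ that is a morphism of varieties and has a neutral element $1$. Its unit group $G(M)$ is the group of invertible elements, an affine algebraic group open in $M$; $\pi:\Bbbk[M]\to\Bbbk[G]$ is the (injective) restriction map. A zero element is $0\in M$ with $0m=m0=0$ for all $m$. The product induces a bialgebra structure on $\Bbbk[M]$. A polynomial $M$-module is a counital comodule $\chi:V\to V\otimes\Bbbk[M]$ for the bialgebra $\Bbbk[M]$ (equivalently, a locally finite action of $M$ by linear maps with regular matrix coefficients), with $m\cdot v=\sum v_1(m)v_0$ if $\chi(v)=\sum v_0\otimes v_1$. A rational $G$-module $\theta:V\to V\otimes\Bbbk[G]$ is called polynomial (with respect to $M$) if $\theta=(\operatorname{id}\otimes\pi)\chi$ for some polynomial $M$-module structure $\chi$ on $V$. For $h\in\Bbbk[M]$, $h\chi$ denotes $\chi$ followed by multiplication by $h$ on the second tensor factor of $V\otimes\Bbbk[M]$; more generally $h\cdot(v\otimes f)=v\otimes hf$. A polynomial character of $M$ is a multiplicative morphism $\lambda:M\to\Bbbk$ with $\lambda(1)=1$; it is trivial if it takes only the value $1$. For $f\in\Bbbk[M]$, $m\in M$, put $(m\cdot f)(x)=f(xm)$ and $(f\cdot m)(x)=f(mx)$. An $\Omega$-process associated to $\lambda$ is a non-zero linear operator $\Omega:\Bbbk[M]\to\Bbbk[M]$ such that $\Omega(f\cdot m)=\lambda(m)\,\Omega(f)\cdot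 m$ and $\Omega(m\cdot f)=\lambda(m)\,m\cdot\Omega(f)$ for all $f\in\Bbbk[M]$, $m\in M$. $\Omega^r$ is the $r$-th iterate ($\Omega^0=\operatorname{id}$). Semi-invariants are allowed to be zero. *)

theory Defs
  imports
    "HOL-Computational_Algebra.Polynomial"
    "HOL-Library.Function_Algebras"
begin

section \<open>Tensor products of vector spaces\<close>

text \<open>
  Vector spaces are carried by a type with an explicit scalar multiplication, as in
  the locale \<^locale>\<open>vector_space\<close>; spaces of functions always carry the pointwise one, \<open>fscale\<close>.
\<close>

definition fscale :: "'k::field \<Rightarrow> ('x \<Rightarrow> 'k) \<Rightarrow> 'x \<Rightarrow> 'k" where
  "fscale c f = (\<lambda>x. c * f x)"

definition bilinear_on ::
  "('k::field \<Rightarrow> 'v::ab_group_add \<Rightarrow> 'v) \<Rightarrow> ('k \<Rightarrow> 'w::ab_group_add \<Rightarrow> 'w) \<Rightarrow>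
   ('k \<Rightarrow> 'u::ab_group_add \<Rightarrow> 'u) \<Rightarrow> 'v set \<Rightarrow> 'w set \<Rightarrow> ('v \<Rightarrow> 'w \<Rightarrow> 'u) \<Rightarrow> bool" where
  "bilinear_on s1 s2 s3 S T b \<longleftrightarrow>
     (\<forall>v\<in>S. \<forall>v'\<in>S. \<forall>w\<in>T. b (v + v') w = b v w + b v' w) \<and>
     (\<forall>v\<in>S. \<forall>w\<in>T. \<forall>w'\<in>T. b v (w + w') = b v w + b v w') \<and>
     (\<forall>c. \<forall>v\<in>S. \<forall>w\<in>T. b (s1 c v) w = s3 c (b v w)) \<and>
     (\<forall>c. \<forall>v\<in>S. \<forall>w\<in>T. b v (s2 c w) = s3 c (b v w))"

text \<open>
  The type of the tensor product of two spaces cannot depend on their scalar multiplications, so the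
  tensor product is realised inside the functionals on bilinear forms: the pure tensor of \<open>v\<close> and
  \<open>w\<close> is evaluation at \<open>(v, w)\<close>. For subspaces \<open>S\<close>, \<open>T\<close> of the ambient spaces, the tensor product of
  \<open>S\<close> and \<open>T\<close> is the set of finite sums of pure tensors from \<open>S\<close> and \<open>T\<close>; over a field it embeds in
  the tensor product of the ambient spaces. The universal property is
  \<open>tensor_universal_property\<close> below.
\<close>

definition tensor ::
  "('k::field \<Rightarrow> 'v::ab_group_add \<Rightarrow> 'v) \<Rightarrow> ('k \<Rightarrow> 'w::ab_group_add \<Rightarrow> 'w) \<Rightarrow>
   'v \<Rightarrow> 'w \<Rightarrow> ('v \<Rightarrow> 'w \<Rightarrow> 'k) \<Rightarrow> 'k" where
  "tensor s1 s2 v w = (\<lambda>b. if bilinear_on s1 s2 (*) UNIV UNIV b then b v w else 0)"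

definition tensor_space ::
  "('k::field \<Rightarrow> 'v::ab_group_add \<Rightarrow> 'v) \<Rightarrow> ('k \<Rightarrow> 'w::ab_group_add \<Rightarrow> 'w) \<Rightarrow>
   'v set \<Rightarrow> 'w set \<Rightarrow> (('v \<Rightarrow> 'w \<Rightarrow> 'k) \<Rightarrow> 'k) set" where
  "tensor_space s1 s2 S T = {\<Sum>(v, w)\<leftarrow>ps. tensor s1 s2 v w | ps. set ps \<subseteq> S \<times> T}"

text \<open>
  The linear map on the tensor product of \<open>S\<close> and \<open>T\<close> induced by a bilinear map \<open>b\<close>: it sends
  \<open>\<Sum> v\<^sub>i \<otimes> w\<^sub>i\<close> to \<open>\<Sum> b v\<^sub>i w\<^sub>i\<close>. All maps given in Sweedler notation are of this form.
\<close>

definition tensor_lift ::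
  "('k::field \<Rightarrow> 'v::ab_group_add \<Rightarrow> 'v) \<Rightarrow> ('k \<Rightarrow> 'w::ab_group_add \<Rightarrow> 'w) \<Rightarrow>
   'v set \<Rightarrow> 'w set \<Rightarrow> ('v \<Rightarrow> 'w \<Rightarrow> 'u::ab_group_add) \<Rightarrow> (('v \<Rightarrow> 'w \<Rightarrow> 'k) \<Rightarrow> 'k) \<Rightarrow> 'u" where
  "tensor_lift s1 s2 S T b t =
     (let ps = SOME ps. set ps \<subseteq> S \<times> T \<and> t = (\<Sum>(v, w)\<leftarrow>ps. tensor s1 s2 v w)
      in \<Sum>(v, w)\<leftarrow>ps. b v w)"

lemma vector_space_fscale: "vector_space fscale"
  by unfold_locales (auto simp: fscale_def fun_eq_iff algebra_simps)

lemma vector_space_mult: "vector_space ((*) :: 'k::field \<Rightarrow> 'k \<Rightarrow> 'k)"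
  by unfold_locales (auto simp: algebra_simps)

lemma bilinear_on_tensor:
  "bilinear_on s1 s2 fscale UNIV UNIV (tensor s1 s2)"
  by (auto simp: bilinear_on_def tensor_def fscale_def fun_eq_iff)

lemma sum_list_fun_apply:
  "(\<Sum>(v, w)\<leftarrow>ps. f v w) x = (\<Sum>(v, w)\<leftarrow>ps. (f v w x :: 'k::ab_group_add))"
  by (induction ps) auto

lemma tensor_sum_eqD:
  fixes s1 :: "'k::field \<Rightarrow> 'v::ab_group_add \<Rightarrow> 'v"
    and s2 :: "'k \<Rightarrow> 'w::ab_group_add \<Rightarrow> 'w"
    and s3 :: "'k \<Rightarrow> 'u::ab_group_add \<Rightarrow> 'u"
  assumes vs: "vector_space s1" "vector_space s2" "vector_space s3"
    and S: "module.subspace s1 S" and T: "module.subspace s2 T"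
    and b: "bilinear_on s1 s2 s3 S T b"
    and ps: "set ps \<subseteq> S \<times> T" and qs: "set qs \<subseteq> S \<times> T"
    and eq: "(\<Sum>(v, w)\<leftarrow>ps. tensor s1 s2 v w) = (\<Sum>(v, w)\<leftarrow>qs. tensor s1 s2 v w)"
  shows "(\<Sum>(v, w)\<leftarrow>ps. b v w) = (\<Sum>(v, w)\<leftarrow>qs. b v w)"
proof (rule ccontr)
  interpret v1: vector_space s1 by fact
  interpret v2: vector_space s2 by fact
  interpret v3: vector_space s3 by fact
  interpret vk: vector_space "(*) :: 'k \<Rightarrow> 'k \<Rightarrow> 'k" by (rule vector_space_mult)
  interpret p11: vector_space_pair s1 s1 by unfold_locales
  interpret p22: vector_space_pair s2 s2 by unfold_locales
  interpret p3k: vector_space_pair s3 "(*) :: 'k \<Rightarrow> 'k \<Rightarrow> 'k" by unfold_locales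
  define d where "d = (\<Sum>(v, w)\<leftarrow>ps. b v w) - (\<Sum>(v, w)\<leftarrow>qs. b v w)"
  assume "(\<Sum>(v, w)\<leftarrow>ps. b v w) \<noteq> (\<Sum>(v, w)\<leftarrow>qs. b v w)"
  then have "d \<noteq> 0" by (simp add: d_def)
  then have "v3.independent {d}" by simp
  from p3k.linear_independent_extend[OF this, of "\<lambda>_. 1"]
  obtain \<phi> where \<phi>: "Vector_Spaces.linear s3 (*) \<phi>" "\<phi> d = (1::'k)" by auto
  interpret \<phi>: Vector_Spaces.linear s3 "(*)" \<phi> by fact
  obtain p where p: "range p \<subseteq> S" "Vector_Spaces.linear s1 s1 p" "\<forall>v\<in>S. p v = v"
    using p11.linear_exists_left_inverse_on[OF v1.linear_id S inj_on_id] by auto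
  obtain q where q: "range q \<subseteq> T" "Vector_Spaces.linear s2 s2 q" "\<forall>v\<in>T. q v = v"
    using p22.linear_exists_left_inverse_on[OF v2.linear_id T inj_on_id] by auto
  interpret p: Vector_Spaces.linear s1 s1 p by fact
  interpret q: Vector_Spaces.linear s2 s2 q by fact
  define b' where "b' = (\<lambda>v w. \<phi> (b (p v) (q w)))"
  have pS: "p v \<in> S" and qT: "q w \<in> T" for v w using p(1) q(1) by auto
  have b': "bilinear_on s1 s2 (*) UNIV UNIV b'"
    using b pS qT unfolding bilinear_on_def b'_def
    by (simp add: p.add q.add p.scale q.scale \<phi>.add \<phi>.scale)
  have ev: "(\<Sum>(v, w)\<leftarrow>rs. tensor s1 s2 v w) b' = \<phi> (\<Sum>(v, w)\<leftarrow>rs. b v w)"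
    if "set rs \<subseteq> S \<times> T" for rs
  proof -
    have "tensor s1 s2 v w b' = \<phi> (b v w)" if "v \<in> S" "w \<in> T" for v w
    proof -
      have "tensor s1 s2 v w b' = b' v w" using b' by (simp add: tensor_def)
      then show ?thesis using that by (simp add: b'_def p(3) q(3))
    qed
    with that show ?thesis by (induction rs) (auto simp: \<phi>.zero \<phi>.add)
  qed
  have "\<phi> d = 0"
    using ev[OF ps] ev[OF qs] eq by (simp add: d_def \<phi>.diff)
  with \<phi>(2) show False by simp
qed

lemma tensor_lift_sum:
  assumes "vector_space s1" "vector_space s2" "vector_space s3"
    and "module.subspace s1 S" "module.subspace s2 T"
    and "bilinear_on s1 s2 s3 S T b" and ps: "set ps \<subseteq> S \<times> T"
  shows "tensor_lift s1 s2 S T b (\<Sum>(v, w)\<leftarrow>ps. tensor s1 s2 v w) = (\<Sum>(v, w)\<leftarrow>ps. b v w)"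
proof -
  let ?P = "\<lambda>qs. set qs \<subseteq> S \<times> T \<and>
    (\<Sum>(v, w)\<leftarrow>ps. tensor s1 s2 v w) = (\<Sum>(v, w)\<leftarrow>qs. tensor s1 s2 v w)"
  define qs where "qs = (SOME qs. ?P qs)"
  have "?P qs" unfolding qs_def by (rule someI[of ?P ps]) (use ps in simp)
  then have "(\<Sum>(v, w)\<leftarrow>ps. b v w) = (\<Sum>(v, w)\<leftarrow>qs. b v w)"
    using tensor_sum_eqD[OF assms(1-6) ps] by blast
  then show ?thesis
    by (simp only: tensor_lift_def Let_def qs_def)
qed

theorem tensor_universal_property:
  fixes s1 :: "'k::field \<Rightarrow> 'v::ab_group_add \<Rightarrow> 'v"
    and s2 :: "'k \<Rightarrow> 'w::ab_group_add \<Rightarrow> 'w"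
    and s3 :: "'k \<Rightarrow> 'u::ab_group_add \<Rightarrow> 'u"
  assumes "vector_space s1" "vector_space s2" "vector_space s3"
    and "module.subspace s1 S" "module.subspace s2 T"
    and b: "bilinear_on s1 s2 s3 S T b"
  shows "\<lbrakk>v \<in> S; w \<in> T\<rbrakk> \<Longrightarrow> tensor_lift s1 s2 S T b (tensor s1 s2 v w) = b v w"
    and "\<lbrakk>t \<in> tensor_space s1 s2 S T; u \<in> tensor_space s1 s2 S T\<rbrakk> \<Longrightarrow>
           tensor_lift s1 s2 S T b (t + u) = tensor_lift s1 s2 S T b t + tensor_lift s1 s2 S T b u"
    and "t \<in> tensor_space s1 s2 S T \<Longrightarrow>
           tensor_lift s1 s2 S T b (fscale c t) = s3 c (tensor_lift s1 s2 S T b t)"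
proof -
  note lift = tensor_lift_sum[OF assms]
  show "tensor_lift s1 s2 S T b (tensor s1 s2 v w) = b v w" if "v \<in> S" "w \<in> T"
    using lift[of "[(v, w)]"] that by simp
  show "tensor_lift s1 s2 S T b (t + u) = tensor_lift s1 s2 S T b t + tensor_lift s1 s2 S T b u"
    if "t \<in> tensor_space s1 s2 S T" "u \<in> tensor_space s1 s2 S T"
  proof -
    from that obtain ps qs where "set ps \<subseteq> S \<times> T" "t = (\<Sum>(v, w)\<leftarrow>ps. tensor s1 s2 v w)"
      "set qs \<subseteq> S \<times> T" "u = (\<Sum>(v, w)\<leftarrow>qs. tensor s1 s2 v w)"
      unfolding tensor_space_def by blast
    then show ?thesis using lift[of ps] lift[of qs] lift[of "ps @ qs"] by simp
  qed
  show "tensor_lift s1 s2 S T b (fscale c t) = s3 c (tensor_lift s1 s2 S T b t)"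
    if "t \<in> tensor_space s1 s2 S T"
  proof -
    interpret v1: vector_space s1 by fact
    interpret v3: vector_space s3 by fact
    interpret f: vector_space "fscale :: 'k \<Rightarrow> (('v \<Rightarrow> 'w \<Rightarrow> 'k) \<Rightarrow> 'k) \<Rightarrow> _" by (rule vector_space_fscale)
    from that obtain ps where ps: "set ps \<subseteq> S \<times> T" "t = (\<Sum>(v, w)\<leftarrow>ps. tensor s1 s2 v w)"
      unfolding tensor_space_def by blast
    let ?qs = "map (\<lambda>(v, w). (s1 c v, w)) ps"
    have qs: "set ?qs \<subseteq> S \<times> T"
      using ps(1) v1.subspace_scale[OF assms(4)] by auto
    have "fscale c t = (\<Sum>(v, w)\<leftarrow>?qs. tensor s1 s2 v w)"
      using bilinear_on_tensor[of s1 s2] unfolding ps(2) bilinear_on_def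
      by (induction ps) (auto simp: f.scale_right_distrib)
    moreover have "(\<Sum>(v, w)\<leftarrow>?qs. b v w) = s3 c (\<Sum>(v, w)\<leftarrow>ps. b v w)"
      using ps(1) b unfolding bilinear_on_def
      by (induction ps) (auto simp: v3.scale_right_distrib)
    ultimately show ?thesis using lift[OF qs] lift[OF ps(1)] ps(2) by simp
  qed
qed

text \<open>The tensor product \<open>f \<otimes> g\<close> of two linear maps defined on \<open>S\<close> and \<open>T\<close>.\<close>

definition tensor_map ::
  "('k::field \<Rightarrow> 'v::ab_group_add \<Rightarrow> 'v) \<Rightarrow> ('k \<Rightarrow> 'w::ab_group_add \<Rightarrow> 'w) \<Rightarrow>
   ('k \<Rightarrow> 'x::ab_group_add \<Rightarrow> 'x) \<Rightarrow> ('k \<Rightarrow> 'y::ab_group_add \<Rightarrow> 'y) \<Rightarrow>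
   'v set \<Rightarrow> 'w set \<Rightarrow> ('v \<Rightarrow> 'x) \<Rightarrow> ('w \<Rightarrow> 'y) \<Rightarrow>
   (('v \<Rightarrow> 'w \<Rightarrow> 'k) \<Rightarrow> 'k) \<Rightarrow> (('x \<Rightarrow> 'y \<Rightarrow> 'k) \<Rightarrow> 'k)" where
  "tensor_map s1 s2 s1' s2' S T f g =
     tensor_lift s1 s2 S T (\<lambda>v w. tensor s1' s2' (f v) (g w))"

text \<open>The canonical map from \<open>V \<otimes> (A \<otimes> B)\<close> to \<open>(V \<otimes> A) \<otimes> B\<close>.\<close>

definition tensor_assoc ::
  "('k::field \<Rightarrow> 'v::ab_group_add \<Rightarrow> 'v) \<Rightarrow> ('x \<Rightarrow> 'k) set \<Rightarrow> ('y \<Rightarrow> 'k) set \<Rightarrow>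
   (('v \<Rightarrow> ((('x \<Rightarrow> 'k) \<Rightarrow> ('y \<Rightarrow> 'k) \<Rightarrow> 'k) \<Rightarrow> 'k) \<Rightarrow> 'k) \<Rightarrow> 'k) \<Rightarrow>
   (((('v \<Rightarrow> ('x \<Rightarrow> 'k) \<Rightarrow> 'k) \<Rightarrow> 'k) \<Rightarrow> ('y \<Rightarrow> 'k) \<Rightarrow> 'k) \<Rightarrow> 'k)" where
  "tensor_assoc sc A B =
     tensor_lift sc fscale UNIV (tensor_space fscale fscale A B)
       (\<lambda>v. tensor_lift fscale fscale A B
              (\<lambda>f g. tensor fscale fscale (tensor sc fscale v f) g))"


section \<open>Affine varieties\<close>

text \<open>
  An affine variety is given by its set of points (a type \<open>'x\<close>) and its coordinate ring, a finitely
  generated algebra \<open>A\<close> of functions \<open>'x \<Rightarrow> 'k\<close> such that every algebra homomorphism from \<open>A\<close> to the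
  algebraically closed field \<open>'k\<close> is evaluation at exactly one point. Choosing generators of \<open>A\<close>
  amounts to choosing a closed embedding of \<open>'x\<close> into an affine space.
\<close>

definition subalgebra :: "('x \<Rightarrow> 'k::field) set \<Rightarrow> bool" where
  "subalgebra A \<longleftrightarrow> (\<forall>c. (\<lambda>_. c) \<in> A) \<and> (\<forall>f\<in>A. \<forall>g\<in>A. f + g \<in> A \<and> f * g \<in> A)"

definition algebra_character :: "('x \<Rightarrow> 'k::field) set \<Rightarrow> (('x \<Rightarrow> 'k) \<Rightarrow> 'k) \<Rightarrow> bool" where
  "algebra_character A \<xi> \<longleftrightarrow> (\<forall>c. \<xi> (\<lambda>_. c) = c) \<and>
     (\<forall>f\<in>A. \<forall>g\<in>A. \<xi> (f + g) = \<xi> f + \<xi> g \<and> \<xi> (f * g) = \<xi> f * \<xi> g)"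

definition affine_variety :: "('x \<Rightarrow> 'k::alg_closed_field) set \<Rightarrow> bool" where
  "affine_variety A \<longleftrightarrow>
     (\<exists>F. finite F \<and> A = subalgebra hull F) \<and>
     (\<forall>\<xi>. algebra_character A \<xi> \<longrightarrow> (\<exists>!x. \<forall>f\<in>A. \<xi> f = f x))"

definition zariski_closed :: "('x \<Rightarrow> 'k::field) set \<Rightarrow> 'x set \<Rightarrow> bool" where
  "zariski_closed A Z \<longleftrightarrow> (\<exists>F\<subseteq>A. Z = {x. \<forall>f\<in>F. f x = 0})"

definition irreducible_variety :: "('x \<Rightarrow> 'k::field) set \<Rightarrow> bool" where
  "irreducible_variety A \<longleftrightarrow>
     (\<forall>Z Z'. zariski_closed A Z \<and> zariski_closed A Z' \<and> Z \<union> Z' = UNIV \<longrightarrow> Z = UNIV \<or> Z' = UNIV)"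

text \<open>
  Normality of an irreducible affine variety: the coordinate ring is integrally closed in its field
  of fractions. The integral equation of the fraction \<open>f / g\<close> is multiplied by \<open>g ^ n\<close>.
\<close>

definition normal_variety :: "('x \<Rightarrow> 'k::field) set \<Rightarrow> bool" where
  "normal_variety A \<longleftrightarrow>
     (\<forall>f\<in>A. \<forall>g\<in>A. g \<noteq> 0 \<longrightarrow>
        (\<exists>n a. (\<forall>i<n. a i \<in> A) \<and> f ^ n + (\<Sum>i<n. a i * f ^ i * g ^ (n - i)) = 0) \<longrightarrow>
        (\<exists>h\<in>A. f = h * g))"

text \<open>The coordinate ring of a product of affine varieties.\<close>

definition product_ring ::
  "('x \<Rightarrow> 'k::field) set \<Rightarrow> ('y \<Rightarrow> 'k) set \<Rightarrow> ('x \<times> 'y \<Rightarrow> 'k) set" where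
  "product_ring A B = subalgebra hull ((\<lambda>f. f \<circ> fst) ` A \<union> (\<lambda>g. g \<circ> snd) ` B)"

definition variety_morphism ::
  "('x \<Rightarrow> 'k::field) set \<Rightarrow> ('y \<Rightarrow> 'k) set \<Rightarrow> ('x \<Rightarrow> 'y) \<Rightarrow> bool" where
  "variety_morphism A B \<phi> \<longleftrightarrow> (\<forall>f\<in>B. f \<circ> \<phi> \<in> A)"


section \<open>Affine algebraic monoids and their unit groups\<close>

definition affine_algebraic_monoid :: "('m::monoid_mult \<Rightarrow> 'k::alg_closed_field) set \<Rightarrow> bool" where
  "affine_algebraic_monoid A \<longleftrightarrow>
     affine_variety A \<and> irreducible_variety A \<and> normal_variety A \<and>
     variety_morphism (product_ring A A) A (\<lambda>(x, y). x * y)"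

typedef (overloaded) 'm unit_group = "{m :: 'm::monoid_mult. \<exists>n. m * n = 1 \<and> n * m = 1}"
  by (rule exI[of _ 1]) simp

instantiation unit_group :: (monoid_mult) monoid_mult
begin

definition one_unit_group :: "'a unit_group" where
  "1 = Abs_unit_group 1"

definition times_unit_group :: "'a unit_group \<Rightarrow> 'a unit_group \<Rightarrow> 'a unit_group" where
  "g * h = Abs_unit_group (Rep_unit_group g * Rep_unit_group h)"

lemma Rep_unit_group_one: "Rep_unit_group (1 :: 'a unit_group) = 1"
  unfolding one_unit_group_def by (rule Abs_unit_group_inverse) auto

lemma Rep_unit_group_times:
  "Rep_unit_group (g * h :: 'a unit_group) = Rep_unit_group g * Rep_unit_group h"
proof -
  obtain g' h' where
    g: "Rep_unit_group g * g' = 1" "g' * Rep_unit_group g = 1" and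
    h: "Rep_unit_group h * h' = 1" "h' * Rep_unit_group h = 1"
    using Rep_unit_group[of g] Rep_unit_group[of h] by auto
  have "Rep_unit_group g * Rep_unit_group h * (h' * g') =
      Rep_unit_group g * (Rep_unit_group h * h') * g'" by (simp only: mult.assoc)
  then have 1: "Rep_unit_group g * Rep_unit_group h * (h' * g') = 1" using g h by simp
  have "h' * g' * (Rep_unit_group g * Rep_unit_group h) =
      h' * (g' * Rep_unit_group g) * Rep_unit_group h" by (simp only: mult.assoc)
  then have 2: "h' * g' * (Rep_unit_group g * Rep_unit_group h) = 1" using g h by simp
  show ?thesis
    unfolding times_unit_group_def
    by (rule Abs_unit_group_inverse, rule CollectI, rule exI[of _ "h' * g'"]) (rule conjI[OF 1 2])
qed

instance
proof
  fix a b c :: "'a unit_group"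
  show "a * b * c = a * (b * c)"
    by (rule Rep_unit_group_inject[THEN iffD1]) (simp only: Rep_unit_group_times mult.assoc)
  show "1 * a = a"
    by (rule Rep_unit_group_inject[THEN iffD1])
      (simp only: Rep_unit_group_times Rep_unit_group_one mult_1_left)
  show "a * 1 = a"
    by (rule Rep_unit_group_inject[THEN iffD1])
      (simp only: Rep_unit_group_times Rep_unit_group_one mult_1_right)
qed

end

text \<open>
  The regular functions on the unit group as an open subset of the monoid: functions which are
  locally quotients of elements of the coordinate ring \<open>A\<close> of the monoid.
\<close>

definition unit_group_ring :: "('m::monoid_mult \<Rightarrow> 'k::field) set \<Rightarrow> ('m unit_group \<Rightarrow> 'k) set" where
  "unit_group_ring A =
     {f. \<forall>x. \<exists>p\<in>A. \<exists>q\<in>A. q (Rep_unit_group x) \<noteq> 0 \<and>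
        (\<forall>y. q (Rep_unit_group y) \<noteq> 0 \<longrightarrow> f y = p (Rep_unit_group y) / q (Rep_unit_group y))}"

definition restrict_units :: "('m::monoid_mult \<Rightarrow> 'k) \<Rightarrow> 'm unit_group \<Rightarrow> 'k" where
  "restrict_units f = f \<circ> Rep_unit_group"

definition polynomial_character ::
  "('m::monoid_mult \<Rightarrow> 'k::field) set \<Rightarrow> ('m \<Rightarrow> 'k) \<Rightarrow> bool" where
  "polynomial_character A l \<longleftrightarrow> l \<in> A \<and> (\<forall>x y. l (x * y) = l x * l y) \<and> l 1 = 1"


section \<open>Comodules\<close>

text \<open>
  In this section \<open>A\<close> is the algebra of regular functions of an algebraic monoid: either the
  coordinate ring of \<open>M\<close>, or \<open>unit_group_ring\<close> of it. The comultiplication sends \<open>f\<close> to the element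
  of \<open>A \<otimes> A\<close> representing the function \<open>(x, y) \<mapsto> f (x * y)\<close>.
\<close>

definition comult ::
  "('m::monoid_mult \<Rightarrow> 'k::field) set \<Rightarrow> ('m \<Rightarrow> 'k) \<Rightarrow>
   ((('m \<Rightarrow> 'k) \<Rightarrow> ('m \<Rightarrow> 'k) \<Rightarrow> 'k) \<Rightarrow> 'k)" where
  "comult A f = (THE t. t \<in> tensor_space fscale fscale A A \<and>
     (\<forall>x y. tensor_lift fscale fscale A A (\<lambda>g h. g x * h y) t = f (x * y)))"

definition counit :: "('m::monoid_mult \<Rightarrow> 'k) \<Rightarrow> 'k" where
  "counit f = f 1"

definition comodule ::
  "('m::monoid_mult \<Rightarrow> 'k::field) set \<Rightarrow> ('k \<Rightarrow> 'v::ab_group_add \<Rightarrow> 'v) \<Rightarrow>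
   ('v \<Rightarrow> (('v \<Rightarrow> ('m \<Rightarrow> 'k) \<Rightarrow> 'k) \<Rightarrow> 'k)) \<Rightarrow> bool" where
  "comodule A sc \<chi> \<longleftrightarrow>
     Vector_Spaces.linear sc fscale \<chi> \<and>
     (\<forall>v. \<chi> v \<in> tensor_space sc fscale UNIV A) \<and>
     (\<forall>v. tensor_map sc fscale fscale fscale UNIV A \<chi> id (\<chi> v) =
          tensor_assoc sc A A (tensor_map sc fscale sc fscale UNIV A id (comult A) (\<chi> v))) \<and>
     (\<forall>v. tensor_lift sc fscale UNIV A (\<lambda>v0 v1. sc (counit v1) v0) (\<chi> v) = v)"

text \<open>The action \<open>m \<cdot> v = \<Sum> v\<^sub>1(m) v\<^sub>0\<close> defined by a comodule structure.\<close>

definition comodule_act ::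
  "('m \<Rightarrow> 'k::field) set \<Rightarrow> ('k \<Rightarrow> 'v::ab_group_add \<Rightarrow> 'v) \<Rightarrow>
   ('v \<Rightarrow> (('v \<Rightarrow> ('m \<Rightarrow> 'k) \<Rightarrow> 'k) \<Rightarrow> 'k)) \<Rightarrow> 'm \<Rightarrow> 'v \<Rightarrow> 'v" where
  "comodule_act A sc \<chi> m v = tensor_lift sc fscale UNIV A (\<lambda>v0 v1. sc (v1 m) v0) (\<chi> v)"

definition comodule_morphism ::
  "('m::monoid_mult \<Rightarrow> 'k::field) set \<Rightarrow>
   ('k \<Rightarrow> 'v::ab_group_add \<Rightarrow> 'v) \<Rightarrow> ('v \<Rightarrow> (('v \<Rightarrow> ('m \<Rightarrow> 'k) \<Rightarrow> 'k) \<Rightarrow> 'k)) \<Rightarrow>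
   ('k \<Rightarrow> 'w::ab_group_add \<Rightarrow> 'w) \<Rightarrow> ('w \<Rightarrow> (('w \<Rightarrow> ('m \<Rightarrow> 'k) \<Rightarrow> 'k) \<Rightarrow> 'k)) \<Rightarrow>
   ('v \<Rightarrow> 'w) \<Rightarrow> bool" where
  "comodule_morphism A sc \<chi> sc' \<chi>' \<phi> \<longleftrightarrow>
     comodule A sc \<chi> \<and> comodule A sc' \<chi>' \<and> Vector_Spaces.linear sc sc' \<phi> \<and>
     \<chi>' \<circ> \<phi> = tensor_map sc fscale sc' fscale UNIV A \<phi> id \<circ> \<chi>"

text \<open>Multiplication of the second tensor factor: \<open>h \<cdot> (v \<otimes> f) = v \<otimes> h f\<close>.\<close>

definition mult_second ::
  "('m \<Rightarrow> 'k::field) set \<Rightarrow> ('k \<Rightarrow> 'v::ab_group_add \<Rightarrow> 'v) \<Rightarrow> ('m \<Rightarrow> 'k) \<Rightarrow>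
   (('v \<Rightarrow> ('m \<Rightarrow> 'k) \<Rightarrow> 'k) \<Rightarrow> 'k) \<Rightarrow> (('v \<Rightarrow> ('m \<Rightarrow> 'k) \<Rightarrow> 'k) \<Rightarrow> 'k)" where
  "mult_second A sc h = tensor_map sc fscale sc fscale UNIV A id (\<lambda>f. h * f)"

text \<open>
  \<open>\<theta>\<close> makes \<open>V\<close> a polynomial module over the unit group, and \<open>\<chi>\<close> is the module structure over the
  monoid with \<open>\<theta> = (id \<otimes> \<pi>) \<chi>\<close>.
\<close>

definition polynomial_unit_module ::
  "('m::monoid_mult \<Rightarrow> 'k::field) set \<Rightarrow> ('k \<Rightarrow> 'v::ab_group_add \<Rightarrow> 'v) \<Rightarrow>
   ('v \<Rightarrow> (('v \<Rightarrow> ('m unit_group \<Rightarrow> 'k) \<Rightarrow> 'k) \<Rightarrow> 'k)) \<Rightarrow>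
   ('v \<Rightarrow> (('v \<Rightarrow> ('m \<Rightarrow> 'k) \<Rightarrow> 'k) \<Rightarrow> 'k)) \<Rightarrow> bool" where
  "polynomial_unit_module A sc \<theta> \<chi> \<longleftrightarrow>
     comodule (unit_group_ring A) sc \<theta> \<and> comodule A sc \<chi> \<and>
     \<theta> = tensor_map sc fscale sc fscale UNIV A id restrict_units \<circ> \<chi>"


section \<open>Omega processes\<close>

definition left_translate :: "'m::monoid_mult \<Rightarrow> ('m \<Rightarrow> 'k) \<Rightarrow> 'm \<Rightarrow> 'k" where
  "left_translate m f = (\<lambda>x. f (x * m))"

definition right_translate :: "('m::monoid_mult \<Rightarrow> 'k) \<Rightarrow> 'm \<Rightarrow> 'm \<Rightarrow> 'k" where
  "right_translate f m = (\<lambda>x. f (m * x))"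

text \<open>Only the values of the operator on \<open>A\<close> are relevant.\<close>

definition omega_process ::
  "('m::monoid_mult \<Rightarrow> 'k::field) set \<Rightarrow> ('m \<Rightarrow> 'k) \<Rightarrow> (('m \<Rightarrow> 'k) \<Rightarrow> ('m \<Rightarrow> 'k)) \<Rightarrow> bool" where
  "omega_process A l \<Omega> \<longleftrightarrow>
     (\<forall>f\<in>A. \<Omega> f \<in> A) \<and>
     (\<forall>f\<in>A. \<forall>g\<in>A. \<Omega> (f + g) = \<Omega> f + \<Omega> g) \<and>
     (\<forall>c. \<forall>f\<in>A. \<Omega> (fscale c f) = fscale c (\<Omega> f)) \<and>
     (\<exists>f\<in>A. \<Omega> f \<noteq> 0) \<and>
     (\<forall>f\<in>A. \<forall>m. \<Omega> (right_translate f m) = fscale (l m) (right_translate (\<Omega> f) m)) \<and>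
     (\<forall>f\<in>A. \<forall>m. \<Omega> (left_translate m f) = fscale (l m) (left_translate m (\<Omega> f)))"

text \<open>The map \<open>v \<mapsto> \<Sum> v\<^sub>0 \<Omega>\<^sup>r(\<lambda>\<^sup>s v\<^sub>1)(0)\<close>.\<close>

definition omega_map ::
  "('m::{monoid_mult,mult_zero} \<Rightarrow> 'k::field) set \<Rightarrow> ('k \<Rightarrow> 'v::ab_group_add \<Rightarrow> 'v) \<Rightarrow>
   ('v \<Rightarrow> (('v \<Rightarrow> ('m \<Rightarrow> 'k) \<Rightarrow> 'k) \<Rightarrow> 'k)) \<Rightarrow>
   ('m \<Rightarrow> 'k) \<Rightarrow> (('m \<Rightarrow> 'k) \<Rightarrow> ('m \<Rightarrow> 'k)) \<Rightarrow> nat \<Rightarrow> nat \<Rightarrow> 'v \<Rightarrow> 'v" where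
  "omega_map A sc \<chi> l \<Omega> r s v =
     tensor_lift sc fscale UNIV A (\<lambda>v0 v1. sc ((\<Omega> ^^ r) (l ^ s * v1) 0) v0) (\<chi> v)"

end

theory Submission
  imports Defs
begin

text \<open>
  An element of \<open>V \<otimes> A\<close> is determined by the map from points to \<open>V\<close> that it defines
  (\<open>slice_points_inject\<close>), so a comodule is the same as a linear action \<open>m \<cdot> v\<close> of the monoid whose
  matrix coefficients lie in \<open>A\<close> (\<open>comodule_iff_action\<close>), and identities between elements of
  \<open>V \<otimes> A\<close> can be verified one point \<open>m\<close> at a time. The character \<open>\<lambda>\<close> is called \<open>l\<close> in the formal text,
  and \<open>f \<cdot> m\<close> and \<open>m \<cdot> f\<close> are \<open>right_translate f m\<close> and \<open>left_translate m f\<close>. Twisting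
  the coaction by \<open>\<lambda>\<^sup>s\<close> changes the action to \<open>\<lambda>(m)\<^sup>s m \<cdot> v\<close>.

  For a linear functional \<open>L\<close> on \<open>A\<close> consider \<open>v \<mapsto> \<Sum> L(v\<^sub>1) v\<^sub>0\<close>. Associativity of the action says that
  applying \<open>m\<close> after this map replaces \<open>L\<close> by \<open>f \<mapsto> L(f \<cdot> m)\<close> (\<open>act_slice\<close>), and that applying \<open>m\<close>
  before it replaces \<open>L\<close> by \<open>f \<mapsto> L(m \<cdot> f)\<close> (\<open>slice_act\<close>). The map \<open>I\<close> is the case
  \<open>L(f) = \<Omega>\<^sup>r(\<lambda>\<^sup>s f)(0)\<close>. Since \<open>\<lambda>(m)\<^sup>s \<lambda>\<^sup>s (f \<cdot> m) = (\<lambda>\<^sup>s f) \<cdot> m\<close>, equivariance of \<open>\<Omega>\<close> and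
  \<open>m 0 = 0 = 0 m\<close> give (\<open>weight_functional_translate\<close>)
  \<open>\<lambda>(m)\<^sup>s L(f \<cdot> m) = \<lambda>(m)\<^sup>r L(f) = \<lambda>(m)\<^sup>s L(m \<cdot> f)\<close>.
  Hence \<open>\<lambda>(m)\<^sup>s m \<cdot> I(v)\<close> and \<open>\<lambda>(m)\<^sup>s I(m \<cdot> v)\<close> are both equal to \<open>\<lambda>(m)\<^sup>r I(v)\<close>. The first of these
  equalities is the second claim, the two together say that \<open>I\<close> commutes with the twisted action,
  and for a unit \<open>m\<close> the first one can be divided by \<open>\<lambda>(m)\<^sup>s\<close>, which gives the third claim.
\<close>

section \<open>Contracting the second tensor factor\<close>

text \<open>
  Linearity relative to a subspace: comultiplication, \<open>\<Omega>\<close> and the maps induced on tensor products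
  have a meaning only on \<open>A\<close> and on \<open>tensor_space\<close>, not on the ambient types.
\<close>

definition linear_map_on ::
  "('k::field \<Rightarrow> 'v::ab_group_add \<Rightarrow> 'v) \<Rightarrow> ('k \<Rightarrow> 'w::ab_group_add \<Rightarrow> 'w) \<Rightarrow> 'v set \<Rightarrow> ('v \<Rightarrow> 'w) \<Rightarrow> bool" where
  "linear_map_on s1 s2 S \<phi> \<longleftrightarrow>
     (\<forall>x\<in>S. \<forall>y\<in>S. \<phi> (x + y) = \<phi> x + \<phi> y) \<and> (\<forall>c. \<forall>x\<in>S. \<phi> (s1 c x) = s2 c (\<phi> x))"

lemma linear_imp_linear_map_on:
  "Vector_Spaces.linear s1 s2 \<phi> \<Longrightarrow> linear_map_on s1 s2 S \<phi>"
  by (simp add: linear_map_on_def Vector_Spaces.linear_iff)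

lemma linear_map_on_id: "linear_map_on s s S id"
  by (simp add: linear_map_on_def)

lemma linear_map_on_point: "linear_map_on fscale (*) A (\<lambda>f. f x)"
  by (simp add: linear_map_on_def fscale_def)

lemma linear_map_on_compose:
  assumes "linear_map_on s1 s2 S f" "linear_map_on s2 s3 T g" "\<And>x. x \<in> S \<Longrightarrow> f x \<in> T"
  shows "linear_map_on s1 s3 S (\<lambda>x. g (f x))"
  using assms by (simp add: linear_map_on_def)

lemma fscale_apply: "fscale c f x = c * f x"
  by (simp add: fscale_def)

interpretation fscale: vector_space fscale
  by (rule vector_space_fscale)

lemma tensor_in_tensor_space:
  "v \<in> S \<Longrightarrow> w \<in> T \<Longrightarrow> tensor s1 s2 v w \<in> tensor_space s1 s2 S T"
  unfolding tensor_space_def by (rule CollectI, rule exI[of _ "[(v, w)]"]) auto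

lemma tensor_space_add:
  assumes "t \<in> tensor_space s1 s2 S T" "u \<in> tensor_space s1 s2 S T"
  shows "t + u \<in> tensor_space s1 s2 S T"
proof -
  from assms obtain ps qs where "set ps \<subseteq> S \<times> T" "t = (\<Sum>(v, w)\<leftarrow>ps. tensor s1 s2 v w)"
    "set qs \<subseteq> S \<times> T" "u = (\<Sum>(v, w)\<leftarrow>qs. tensor s1 s2 v w)"
    unfolding tensor_space_def by blast
  then show ?thesis
    unfolding tensor_space_def by (intro CollectI exI[of _ "ps @ qs"]) auto
qed

lemma tensor_add_left: "tensor s1 s2 (v + v') w = tensor s1 s2 v w + tensor s1 s2 v' w"
  and tensor_add_right: "tensor s1 s2 v (w + w') = tensor s1 s2 v w + tensor s1 s2 v w'"
  and tensor_scale_left: "tensor s1 s2 (s1 c v) w = fscale c (tensor s1 s2 v w)"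
  and tensor_scale_right: "tensor s1 s2 v (s2 c w) = fscale c (tensor s1 s2 v w)"
  using bilinear_on_tensor[of s1 s2] by (simp_all add: bilinear_on_def)

locale subspace_pair = v1: vector_space s1 + v2: vector_space s2
  for s1 :: "'k::field \<Rightarrow> 'v::ab_group_add \<Rightarrow> 'v" and s2 :: "'k \<Rightarrow> 'w::ab_group_add \<Rightarrow> 'w" +
  fixes S :: "'v set" and T :: "'w set"
  assumes subspace_S: "v1.subspace S" and subspace_T: "v2.subspace T"
begin

lemma tensor_zero_left: "tensor s1 s2 0 w = 0"
  using tensor_scale_left[of s1 s2 0 0 w] by simp

lemma tensor_zero_right: "tensor s1 s2 v 0 = 0"
  using tensor_scale_right[of s1 s2 v 0 0] by simp

lemma tensor_minus_left: "tensor s1 s2 (- v) w = - tensor s1 s2 v w"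
  using tensor_add_left[of s1 s2 "- v" v w] by (simp add: tensor_zero_left eq_neg_iff_add_eq_0)

text \<open>
  Maps out of a tensor product are compared by induction on this rule; zero needs no case, being the
  pure tensor of zero and zero.
\<close>

lemma tensor_space_induct [consumes 1, case_names pure add]:
  assumes t: "t \<in> tensor_space s1 s2 S T"
    and pure: "\<And>v w. v \<in> S \<Longrightarrow> w \<in> T \<Longrightarrow> P (tensor s1 s2 v w)"
    and add: "\<And>t u. \<lbrakk>t \<in> tensor_space s1 s2 S T; u \<in> tensor_space s1 s2 S T; P t; P u\<rbrakk> \<Longrightarrow> P (t + u)"
  shows "P t"
proof -
  from t obtain ps where ps: "set ps \<subseteq> S \<times> T" "t = (\<Sum>(v, w)\<leftarrow>ps. tensor s1 s2 v w)"
    unfolding tensor_space_def by blast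
  have "P (tensor s1 s2 0 0)" and 0: "0 \<in> S" "0 \<in> T"
    using pure v1.subspace_0[OF subspace_S] v2.subspace_0[OF subspace_T] by auto
  then have P0: "P 0" "0 \<in> tensor_space s1 s2 S T"
    using tensor_in_tensor_space[OF 0, of s1 s2] by (simp_all add: tensor_zero_left)
  have "P (\<Sum>(v, w)\<leftarrow>ps. tensor s1 s2 v w) \<and> (\<Sum>(v, w)\<leftarrow>ps. tensor s1 s2 v w) \<in> tensor_space s1 s2 S T"
    using ps(1)
    by (induction ps) (auto simp: P0 intro!: add pure tensor_in_tensor_space tensor_space_add)
  then show ?thesis by (simp add: ps(2))
qed

lemma subspace_tensor_space: "fscale.subspace (tensor_space s1 s2 S T)"
proof (rule fscale.subspaceI)
  have 0: "0 \<in> S" "0 \<in> T"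
    using v1.subspace_0[OF subspace_S] v2.subspace_0[OF subspace_T] by auto
  show "0 \<in> tensor_space s1 s2 S T"
    using tensor_in_tensor_space[OF 0, of s1 s2] by (simp add: tensor_zero_left)
  show "fscale c t \<in> tensor_space s1 s2 S T" if "t \<in> tensor_space s1 s2 S T" for c t
    using that
  proof (induction rule: tensor_space_induct)
    case (pure v w)
    then show ?case
      using v1.subspace_scale[OF subspace_S]
      by (metis tensor_in_tensor_space tensor_scale_left)
  qed (simp add: fscale.scale_right_distrib tensor_space_add del: plus_fun_apply)
qed (rule tensor_space_add)

context
  fixes s3 :: "'k \<Rightarrow> 'u::ab_group_add \<Rightarrow> 'u" and b
  assumes s3: "vector_space s3" and b: "bilinear_on s1 s2 s3 S T b"
begin

lemmas lift_pure =
  tensor_universal_property(1)[OF v1.vector_space_axioms v2.vector_space_axioms s3 subspace_S subspace_T b]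
lemmas lift_add =
  tensor_universal_property(2)[OF v1.vector_space_axioms v2.vector_space_axioms s3 subspace_S subspace_T b]
lemmas lift_scale =
  tensor_universal_property(3)[OF v1.vector_space_axioms v2.vector_space_axioms s3 subspace_S subspace_T b]

lemma linear_map_on_lift: "linear_map_on fscale s3 (tensor_space s1 s2 S T) (tensor_lift s1 s2 S T b)"
  by (simp add: linear_map_on_def lift_add lift_scale)

lemma lift_in:
  assumes "\<And>v w. v \<in> S \<Longrightarrow> w \<in> T \<Longrightarrow> b v w \<in> W" "\<And>x y. x \<in> W \<Longrightarrow> y \<in> W \<Longrightarrow> x + y \<in> W"
    and "t \<in> tensor_space s1 s2 S T"
  shows "tensor_lift s1 s2 S T b t \<in> W"
  using assms(3) by (induction rule: tensor_space_induct) (simp_all add: lift_pure lift_add assms del: plus_fun_apply)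

lemma lift_unique:
  assumes "linear_map_on fscale s3 (tensor_space s1 s2 S T) F"
    and "\<And>v w. v \<in> S \<Longrightarrow> w \<in> T \<Longrightarrow> F (tensor s1 s2 v w) = b v w"
    and "t \<in> tensor_space s1 s2 S T"
  shows "F t = tensor_lift s1 s2 S T b t"
  using assms(3)
  by (induction rule: tensor_space_induct)
    (use assms(1,2) in \<open>simp_all add: lift_pure lift_add linear_map_on_def del: plus_fun_apply\<close>)

end

end

locale function_tensor = v1: vector_space sc
  for sc :: "'k::field \<Rightarrow> 'v::ab_group_add \<Rightarrow> 'v" +
  fixes S :: "'v set" and A :: "('x \<Rightarrow> 'k) set"
  assumes subspace_S: "v1.subspace S" and subspace_A: "fscale.subspace A"

sublocale function_tensor \<subseteq> subspace_pair sc fscale S A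
  by unfold_locales (rule subspace_S, rule subspace_A)

text \<open>
  The contraction \<open>id \<otimes> L\<close> of \<open>S \<otimes> A\<close> into \<open>S\<close>. Evaluation at a point, the action of a monoid element,
  the counit axiom and \<open>omega_map\<close> are all contractions, for different functionals \<open>L\<close>.
\<close>

definition slice ::
  "('k::field \<Rightarrow> 'v::ab_group_add \<Rightarrow> 'v) \<Rightarrow> 'v set \<Rightarrow> ('x \<Rightarrow> 'k) set \<Rightarrow> (('x \<Rightarrow> 'k) \<Rightarrow> 'k) \<Rightarrow>
   (('v \<Rightarrow> ('x \<Rightarrow> 'k) \<Rightarrow> 'k) \<Rightarrow> 'k) \<Rightarrow> 'v" where
  "slice sc S A L = tensor_lift sc fscale S A (\<lambda>v f. sc (L f) v)"

context function_tensor
begin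

context
  fixes L assumes L: "linear_map_on fscale (*) A L"
begin

lemma bilinear_slice: "bilinear_on sc fscale sc S A (\<lambda>v f. sc (L f) v)"
  using L by (auto simp: bilinear_on_def linear_map_on_def v1.scale_left_distrib
      v1.scale_right_distrib mult.commute)

lemma slice_pure: "v \<in> S \<Longrightarrow> f \<in> A \<Longrightarrow> slice sc S A L (tensor sc fscale v f) = sc (L f) v"
  unfolding slice_def by (rule lift_pure[OF v1.vector_space_axioms bilinear_slice])

lemma linear_map_on_slice: "linear_map_on fscale sc (tensor_space sc fscale S A) (slice sc S A L)"
  unfolding slice_def by (rule linear_map_on_lift[OF v1.vector_space_axioms bilinear_slice])

lemma slice_in: "t \<in> tensor_space sc fscale S A \<Longrightarrow> slice sc S A L t \<in> S"
  unfolding slice_def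
  by (rule lift_in[OF v1.vector_space_axioms bilinear_slice])
    (auto intro: v1.subspace_scale[OF subspace_S] v1.subspace_add[OF subspace_S])

lemma slice_unique:
  assumes "linear_map_on fscale sc (tensor_space sc fscale S A) F"
    and "\<And>v f. v \<in> S \<Longrightarrow> f \<in> A \<Longrightarrow> F (tensor sc fscale v f) = sc (L f) v"
    and "t \<in> tensor_space sc fscale S A"
  shows "F t = slice sc S A L t"
  unfolding slice_def by (rule lift_unique[OF v1.vector_space_axioms bilinear_slice assms])

end

text \<open>
  The two scalars allow a factor such as \<open>\<lambda>(m)\<^sup>s\<close>, which may vanish, to stay on the left of an
  equivariance law \<open>c L'(f) = c' L(f)\<close>.
\<close>

lemma slice_proportional:
  assumes L: "linear_map_on fscale (*) A L" and L': "linear_map_on fscale (*) A L'"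
    and eq: "\<And>f. f \<in> A \<Longrightarrow> c * L' f = c' * L f"
    and t: "t \<in> tensor_space sc fscale S A"
  shows "sc c (slice sc S A L' t) = sc c' (slice sc S A L t)"
  using t
proof (induction rule: tensor_space_induct)
  case (pure v f)
  then show ?case by (simp add: slice_pure L L' eq)
next
  case (add t u)
  then show ?case
    using linear_map_on_slice[OF L] linear_map_on_slice[OF L']
    by (simp add: linear_map_on_def v1.scale_right_distrib del: plus_fun_apply)
qed

text \<open>
  Injectivity of \<open>V \<otimes> A \<rightarrow> (points \<rightarrow> V)\<close>, by induction on the number of pure tensors. If some
  \<open>f \<noteq> 0\<close> occurs, say \<open>f(x) \<noteq> 0\<close>, the vanishing at \<open>x\<close> expresses its partner \<open>v\<close> through the
  remaining vectors \<open>u\<close>; substituting this replaces every other term \<open>u \<otimes> g\<close> by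
  \<open>u \<otimes> (g - g(x)/f(x) f)\<close> and removes \<open>v \<otimes> f\<close>.
\<close>

lemma tensor_sum_eq_0:
  assumes "set ps \<subseteq> UNIV \<times> A" and "\<And>x. (\<Sum>(v, f)\<leftarrow>ps. sc (f x) v) = 0"
  shows "(\<Sum>(v, f)\<leftarrow>ps. tensor sc fscale v f) = 0"
  using assms
proof (induction "length ps" arbitrary: ps)
  case 0
  then show ?case by simp
next
  case (Suc n)
  obtain v f qs where ps: "ps = (v, f) # qs" using Suc(2) by (cases ps) auto
  have f: "f \<in> A" and qs: "set qs \<subseteq> UNIV \<times> A" using Suc(3) ps by auto
  have vanish: "sc (f x) v + (\<Sum>(v, f)\<leftarrow>qs. sc (f x) v) = 0" for x
    using Suc(4)[of x] by (simp add: ps)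
  show ?case
  proof (cases "f = 0")
    case True
    then have "(\<Sum>(v, f)\<leftarrow>qs. tensor sc fscale v f) = 0"
      using vanish by (intro Suc(1)[of qs]) (use Suc(2) qs ps in auto)
    with True show ?thesis by (simp add: ps tensor_zero_right)
  next
    case False
    then obtain x where x: "f x \<noteq> 0" by (auto simp: fun_eq_iff)
    define red where "red = map (\<lambda>(u, g). (u, g - fscale (g x / f x) f)) qs"
    have lin: "(\<Sum>(u, g)\<leftarrow>us. sc (g y / f y') u) = sc (1 / f y') (\<Sum>(u, g)\<leftarrow>us. sc (g y) u)"
      for us :: "('v \<times> ('x \<Rightarrow> 'k)) list" and y y'
      by (induction us) (auto simp: v1.scale_right_distrib)
    have v: "v = - (\<Sum>(u, g)\<leftarrow>qs. sc (g x / f x) u)"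
    proof -
      have "sc (1 / f x) (sc (f x) v + (\<Sum>(v, f)\<leftarrow>qs. sc (f x) v)) = 0"
        using vanish[of x] by simp
      then have "v + (\<Sum>(u, g)\<leftarrow>qs. sc (g x / f x) u) = 0"
        using x by (simp add: v1.scale_right_distrib lin)
      then show ?thesis by (simp add: eq_neg_iff_add_eq_0)
    qed
    have "(\<Sum>(u, g)\<leftarrow>red. sc (g y) u) = 0" for y
    proof -
      have "(\<Sum>(u, g)\<leftarrow>red. sc (g y) u) =
          (\<Sum>(u, g)\<leftarrow>qs. sc (g y) u) - sc (f y) (\<Sum>(u, g)\<leftarrow>qs. sc (g x / f x) u)"
        unfolding red_def
        by (induction qs) (auto simp: v1.scale_left_diff_distrib v1.scale_right_distrib fscale_def
            mult.commute)
      also have "\<dots> = (\<Sum>(u, g)\<leftarrow>qs. sc (g y) u) + sc (f y) v" by (subst v) simp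
      finally show ?thesis using vanish[of y] by (simp add: add.commute)
    qed
    moreover have "set red \<subseteq> UNIV \<times> A"
      using qs f fscale.subspace_diff[OF subspace_A] fscale.subspace_scale[OF subspace_A]
      by (auto simp: red_def)
    ultimately have red0: "(\<Sum>(u, g)\<leftarrow>red. tensor sc fscale u g) = 0"
      using Suc(2) ps by (intro Suc(1)) (auto simp: red_def)
    have "tensor sc fscale u (g - fscale c f) = tensor sc fscale u g - tensor sc fscale (sc c u) f"
      for u g c
      using tensor_add_right[of sc fscale u "g - fscale c f" "fscale c f"]
      by (simp add: tensor_scale_left tensor_scale_right)
    then have "(\<Sum>(u, g)\<leftarrow>red. tensor sc fscale u g) =
        (\<Sum>(u, g)\<leftarrow>qs. tensor sc fscale u g) - tensor sc fscale (\<Sum>(u, g)\<leftarrow>qs. sc (g x / f x) u) f"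
      unfolding red_def by (induction qs) (auto simp: tensor_zero_left tensor_add_left)
    also have "\<dots> = (\<Sum>(u, g)\<leftarrow>qs. tensor sc fscale u g) + tensor sc fscale v f"
      by (simp add: v tensor_minus_left)
    finally show ?thesis using red0 by (simp add: ps add.commute)
  qed
qed

lemma slice_points_inject:
  assumes t: "t \<in> tensor_space sc fscale S A" and u: "u \<in> tensor_space sc fscale S A"
    and eq: "\<And>x. slice sc S A (\<lambda>f. f x) t = slice sc S A (\<lambda>f. f x) u"
  shows "t = u"
proof -
  have "t - u \<in> tensor_space sc fscale S A"
    by (rule fscale.subspace_diff[OF subspace_tensor_space t u])
  then obtain ps where ps: "set ps \<subseteq> S \<times> A" "t - u = (\<Sum>(v, f)\<leftarrow>ps. tensor sc fscale v f)"
    unfolding tensor_space_def by blast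
  have "(\<Sum>(v, f)\<leftarrow>ps. sc (f x) v) = 0" for x
  proof -
    have *: "slice sc S A (\<lambda>f. f x) (t - u + u) =
        slice sc S A (\<lambda>f. f x) (t - u) + slice sc S A (\<lambda>f. f x) u"
      using linear_map_on_slice[OF linear_map_on_point[of A x]] \<open>t - u \<in> _\<close> u
      unfolding linear_map_on_def by blast
    have "slice sc S A (\<lambda>f. f x) (t - u) = (\<Sum>(v, f)\<leftarrow>ps. sc (f x) v)"
      unfolding slice_def ps(2)
      by (rule tensor_lift_sum[OF v1.vector_space_axioms fscale.vector_space_axioms
            v1.vector_space_axioms subspace_S subspace_A
            bilinear_slice[OF linear_map_on_point] ps(1)])
    with * eq[of x] show ?thesis by simp
  qed
  then have "t - u = 0"
    unfolding ps(2) by (intro tensor_sum_eq_0) (use ps(1) in auto)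
  then show ?thesis by simp
qed

context
  fixes s' :: "'k \<Rightarrow> 'w::ab_group_add \<Rightarrow> 'w" and S' and A' :: "('y \<Rightarrow> 'k) set" and \<phi> \<gamma>
  assumes target: "function_tensor s' S' A'"
    and \<phi>: "linear_map_on sc s' S \<phi>" "\<And>v. v \<in> S \<Longrightarrow> \<phi> v \<in> S'"
    and \<gamma>: "linear_map_on fscale fscale A \<gamma>" "\<And>f. f \<in> A \<Longrightarrow> \<gamma> f \<in> A'"
begin

interpretation t: function_tensor s' S' A' by (rule target)

lemma bilinear_tensor_map: "bilinear_on sc fscale fscale S A (\<lambda>v f. tensor s' fscale (\<phi> v) (\<gamma> f))"
  using \<phi>(1) \<gamma>(1)
  by (simp add: bilinear_on_def linear_map_on_def tensor_add_left tensor_add_right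
      tensor_scale_left tensor_scale_right)

lemma tensor_map_in:
  "t \<in> tensor_space sc fscale S A \<Longrightarrow>
   tensor_map sc fscale s' fscale S A \<phi> \<gamma> t \<in> tensor_space s' fscale S' A'"
  unfolding tensor_map_def
  by (rule lift_in[OF fscale.vector_space_axioms bilinear_tensor_map])
    (auto intro: tensor_in_tensor_space tensor_space_add \<phi>(2) \<gamma>(2))

lemma linear_map_on_tensor_map:
  "linear_map_on fscale fscale (tensor_space sc fscale S A) (tensor_map sc fscale s' fscale S A \<phi> \<gamma>)"
  unfolding tensor_map_def
  by (rule linear_map_on_lift[OF fscale.vector_space_axioms bilinear_tensor_map])

lemma slice_tensor_map:
  assumes L: "linear_map_on fscale (*) A' L" and t: "t \<in> tensor_space sc fscale S A"
  shows "slice s' S' A' L (tensor_map sc fscale s' fscale S A \<phi> \<gamma> t) =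
    \<phi> (slice sc S A (\<lambda>f. L (\<gamma> f)) t)"
proof -
  have L': "linear_map_on fscale (*) A (\<lambda>f. L (\<gamma> f))"
    by (rule linear_map_on_compose[OF \<gamma>(1) L \<gamma>(2)])
  have lin: "linear_map_on fscale s' (tensor_space sc fscale S A)
      (\<lambda>t. \<phi> (slice sc S A (\<lambda>f. L (\<gamma> f)) t))"
    by (rule linear_map_on_compose[OF linear_map_on_slice[OF L'] \<phi>(1)]) (rule slice_in[OF L'])
  have lin': "linear_map_on fscale s' (tensor_space sc fscale S A)
      (\<lambda>t. slice s' S' A' L (tensor_map sc fscale s' fscale S A \<phi> \<gamma> t))"
    by (rule linear_map_on_compose[OF linear_map_on_tensor_map t.linear_map_on_slice[OF L]])
      (rule tensor_map_in)
  show ?thesis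
    using t
  proof (induction rule: tensor_space_induct)
    case (pure v f)
    have "tensor_map sc fscale s' fscale S A \<phi> \<gamma> (tensor sc fscale v f) = tensor s' fscale (\<phi> v) (\<gamma> f)"
      unfolding tensor_map_def
      by (rule lift_pure[OF fscale.vector_space_axioms bilinear_tensor_map pure])
    then show ?case
      using pure \<phi> \<gamma>(2) by (simp add: slice_pure[OF L'] t.slice_pure[OF L] linear_map_on_def)
  next
    case (add t u)
    then show ?case using lin lin' by (simp add: linear_map_on_def del: plus_fun_apply)
  qed
qed

end

end

section \<open>Algebras of functions on a monoid\<close>

lemma subspace_subalgebra: "subalgebra A \<Longrightarrow> fscale.subspace A"
proof (rule fscale.subspaceI)
  assume A: "subalgebra A"
  then show "0 \<in> A" unfolding subalgebra_def zero_fun_def by blast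
  show "f + g \<in> A" if "f \<in> A" "g \<in> A" for f g using A that unfolding subalgebra_def by blast
  show "fscale c f \<in> A" if "f \<in> A" for c f
  proof -
    have "fscale c f = (\<lambda>_. c) * f" by (simp add: fscale_def fun_eq_iff)
    then show ?thesis using A that by (simp add: subalgebra_def)
  qed
qed

text \<open>
  Sums of products \<open>g(x) h(y)\<close> form a subalgebra that contains the generators of the product ring.
\<close>

lemma product_ring_as_sum:
  assumes A: "subalgebra A" and B: "subalgebra B" and F: "F \<in> product_ring A B"
  shows "\<exists>ps. set ps \<subseteq> A \<times> B \<and> (\<forall>x y. F (x, y) = (\<Sum>(g, h)\<leftarrow>ps. g x * h y))"
proof -
  define R where "R = {F. \<exists>ps. set ps \<subseteq> A \<times> B \<and> (\<forall>x y. F (x, y) = (\<Sum>(g, h)\<leftarrow>ps. g x * h y))}"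
  have const: "(\<lambda>_. c) \<in> A" "(\<lambda>_. c) \<in> B" for c
    using A B by (auto simp: subalgebra_def)
  have pure: "(\<lambda>(x, y). g x * h y) \<in> R" if "g \<in> A" "h \<in> B" for g h
    unfolding R_def by (intro CollectI exI[of _ "[(g, h)]"]) (use that in auto)
  have add: "F + G \<in> R" if "F \<in> R" "G \<in> R" for F G
  proof -
    from that obtain ps qs where "set ps \<subseteq> A \<times> B" "\<forall>x y. F (x, y) = (\<Sum>(g, h)\<leftarrow>ps. g x * h y)"
      "set qs \<subseteq> A \<times> B" "\<forall>x y. G (x, y) = (\<Sum>(g, h)\<leftarrow>qs. g x * h y)"
      unfolding R_def by blast
    then show ?thesis unfolding R_def by (intro CollectI exI[of _ "ps @ qs"]) auto
  qed
  have scale: "(\<lambda>(x, y). g x * h y * F (x, y)) \<in> R" if gh: "g \<in> A" "h \<in> B" and F: "F \<in> R" for g h F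
  proof -
    from F obtain ps where ps: "set ps \<subseteq> A \<times> B" "\<forall>x y. F (x, y) = (\<Sum>(g, h)\<leftarrow>ps. g x * h y)"
      unfolding R_def by blast
    have "g x * h y * (\<Sum>(g, h)\<leftarrow>ps. g x * h y) =
        (\<Sum>(g, h)\<leftarrow>map (\<lambda>(g', h'). (g * g', h * h')) ps. g x * h y)" for x y
      by (induction ps) (auto simp: algebra_simps)
    moreover have "set (map (\<lambda>(g', h'). (g * g', h * h')) ps) \<subseteq> A \<times> B"
      using ps(1) gh A B unfolding subalgebra_def by auto
    ultimately show ?thesis
      unfolding R_def using ps(2)
      by (intro CollectI exI[of _ "map (\<lambda>(g', h'). (g * g', h * h')) ps"]) simp
  qed
  have mult: "F * G \<in> R" if F: "F \<in> R" and G: "G \<in> R" for F G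
  proof -
    from F obtain ps where ps: "set ps \<subseteq> A \<times> B" "\<forall>x y. F (x, y) = (\<Sum>(g, h)\<leftarrow>ps. g x * h y)"
      unfolding R_def by blast
    from ps(1) have "(\<lambda>(x, y). (\<Sum>(g, h)\<leftarrow>ps. g x * h y) * G (x, y)) \<in> R"
    proof (induction ps)
      case Nil
      then show ?case using pure[OF const, of 0 0] by (simp add: case_prod_unfold)
    next
      case (Cons p ps)
      obtain g h where p: "p = (g, h)" by force
      have "(\<lambda>(x, y). g x * h y * G (x, y)) + (\<lambda>(x, y). (\<Sum>(g, h)\<leftarrow>ps. g x * h y) * G (x, y)) \<in> R"
        using Cons p by (intro add scale G) auto
      then show ?case by (simp add: p plus_fun_def case_prod_unfold distrib_right)
    qed
    also have "(\<lambda>(x, y). (\<Sum>(g, h)\<leftarrow>ps. g x * h y) * G (x, y)) = F * G"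
      using ps(2) by (auto simp: fun_eq_iff)
    finally show ?thesis .
  qed
  have "(\<lambda>_. c) \<in> R" for c
    using pure[OF const, of c 1] by (simp add: case_prod_unfold)
  then have "subalgebra R"
    using add mult by (simp add: subalgebra_def)
  moreover have "g \<circ> fst \<in> R" if "g \<in> A" for g
    using pure[OF that const(2), of 1] by (simp add: case_prod_unfold comp_def)
  moreover have "h \<circ> snd \<in> R" if "h \<in> B" for h
    using pure[OF const(1) that, of 1] by (simp add: case_prod_unfold comp_def)
  ultimately have "product_ring A B \<subseteq> R"
    unfolding product_ring_def by (intro hull_minimal) auto
  then show ?thesis using F by (auto simp: R_def)
qed

text \<open>
  What the theory of comodules uses of an algebraic monoid: the function \<open>(x, y) \<mapsto> f(x y)\<close> is the
  function of some element of \<open>A \<otimes> A\<close>.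
\<close>

locale monoid_function_ring =
  fixes A :: "('m::monoid_mult \<Rightarrow> 'k::field) set"
  assumes subalgebra_A: "subalgebra A"
    and comult_exists: "f \<in> A \<Longrightarrow> \<exists>t\<in>tensor_space fscale fscale A A.
      \<forall>x y. tensor_lift fscale fscale A A (\<lambda>g h. g x * h y) t = f (x * y)"

lemma affine_algebraic_monoid_function_ring:
  assumes "affine_algebraic_monoid A"
  shows "monoid_function_ring A"
proof
  from assms obtain F where "A = subalgebra hull F"
    unfolding affine_algebraic_monoid_def affine_variety_def by blast
  moreover have "subalgebra (subalgebra hull F)"
    by (rule hull_in) (auto simp: subalgebra_def)
  ultimately show A: "subalgebra A" by simp
  fix f assume "f \<in> A"
  then have "f \<circ> (\<lambda>(x, y). x * y) \<in> product_ring A A"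
    using assms unfolding affine_algebraic_monoid_def variety_morphism_def by blast
  from product_ring_as_sum[OF A A this] obtain ps where ps: "set ps \<subseteq> A \<times> A"
    "\<And>x y. f (x * y) = (\<Sum>(g, h)\<leftarrow>ps. g x * h y)" by auto
  have "tensor_lift fscale fscale A A (\<lambda>g h. g x * h y) (\<Sum>(g, h)\<leftarrow>ps. tensor fscale fscale g h) =
      f (x * y)" for x y
    unfolding ps(2)
    by (rule tensor_lift_sum[OF vector_space_fscale vector_space_fscale vector_space_mult
          subspace_subalgebra[OF A] subspace_subalgebra[OF A] _ ps(1)])
      (auto simp: bilinear_on_def fscale_def algebra_simps)
  then show "\<exists>t\<in>tensor_space fscale fscale A A.
      \<forall>x y. tensor_lift fscale fscale A A (\<lambda>g h. g x * h y) t = f (x * y)"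
    using ps(1) unfolding tensor_space_def by blast
qed

sublocale monoid_function_ring \<subseteq> AA: function_tensor fscale A A
  by unfold_locales (auto intro: subspace_subalgebra subalgebra_A)

lemma left_translate_apply: "left_translate m f x = f (x * m)"
  and right_translate_apply: "right_translate f m x = f (m * x)"
  and restrict_units_apply: "restrict_units f g = f (Rep_unit_group g)"
  by (simp_all add: left_translate_def right_translate_def restrict_units_def)

context monoid_function_ring
begin

lemma A_times: "f \<in> A \<Longrightarrow> g \<in> A \<Longrightarrow> f * g \<in> A"
  using subalgebra_A by (simp add: subalgebra_def)

lemma bilinear_values: "bilinear_on fscale fscale (*) A A (\<lambda>g h. g x * h y)"
  by (auto simp: bilinear_on_def fscale_def algebra_simps)

lemmas values_pure = AA.lift_pure[OF vector_space_mult bilinear_values]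
lemmas values_add = AA.lift_add[OF vector_space_mult bilinear_values]
lemmas linear_map_on_values = AA.linear_map_on_lift[OF vector_space_mult bilinear_values]

text \<open>
  A slice of an element of \<open>A \<otimes> A\<close> is itself a function on the monoid, so evaluating twice reduces
  injectivity of \<open>A \<otimes> A \<rightarrow> functions of (x, y)\<close> to injectivity for slices. This makes the
  description that defines \<open>comult\<close> unique.
\<close>

lemma values_eq_slice:
  assumes "t \<in> tensor_space fscale fscale A A"
  shows "tensor_lift fscale fscale A A (\<lambda>g h. g x * h y) t = slice fscale A A (\<lambda>h. h y) t x"
proof (rule AA.lift_unique[OF vector_space_mult bilinear_values _ _ assms, symmetric])
  show "linear_map_on fscale (*) (tensor_space fscale fscale A A) (\<lambda>t. slice fscale A A (\<lambda>h. h y) t x)"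
    by (rule linear_map_on_compose[OF AA.linear_map_on_slice[OF linear_map_on_point]
          linear_map_on_point[of UNIV]]) simp
  show "slice fscale A A (\<lambda>h. h y) (tensor fscale fscale g h) x = g x * h y"
    if "g \<in> A" "h \<in> A" for g h
    by (subst AA.slice_pure[OF linear_map_on_point that]) (simp add: fscale_apply)
qed

lemma values_inject:
  assumes "t \<in> tensor_space fscale fscale A A" "u \<in> tensor_space fscale fscale A A"
    and "\<And>x y. tensor_lift fscale fscale A A (\<lambda>g h. g x * h y) t =
      tensor_lift fscale fscale A A (\<lambda>g h. g x * h y) u"
  shows "t = u"
  using assms(3)
  by (intro AA.slice_points_inject assms(1,2)) (simp add: values_eq_slice assms(1,2) fun_eq_iff)

lemma comult_in: "f \<in> A \<Longrightarrow> comult A f \<in> tensor_space fscale fscale A A"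
  and comult_values: "f \<in> A \<Longrightarrow>
    tensor_lift fscale fscale A A (\<lambda>g h. g x * h y) (comult A f) = f (x * y)"
proof -
  assume f: "f \<in> A"
  have "\<exists>!t. t \<in> tensor_space fscale fscale A A \<and>
      (\<forall>x y. tensor_lift fscale fscale A A (\<lambda>g h. g x * h y) t = f (x * y))"
    using comult_exists[OF f] by (auto intro: values_inject)
  from theI'[OF this] show "comult A f \<in> tensor_space fscale fscale A A"
    "tensor_lift fscale fscale A A (\<lambda>g h. g x * h y) (comult A f) = f (x * y)"
    unfolding comult_def by auto
qed

lemma linear_map_on_comult: "linear_map_on fscale fscale A (comult A)"
  unfolding linear_map_on_def
proof (intro conjI ballI allI)
  fix f g assume f: "f \<in> A" and g: "g \<in> A"
  then have "f + g \<in> A" using subalgebra_A by (simp add: subalgebra_def)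
  then show "comult A (f + g) = comult A f + comult A g"
    using f g
    by (intro values_inject) (simp_all add: comult_in tensor_space_add comult_values values_add)
next
  fix c f assume f: "f \<in> A"
  then have "fscale c f \<in> A" by (rule fscale.subspace_scale[OF AA.subspace_A])
  then show "comult A (fscale c f) = fscale c (comult A f)"
    using f linear_map_on_values fscale.subspace_scale[OF AA.subspace_tensor_space comult_in[OF f]]
    by (intro values_inject) (simp_all add: comult_in comult_values linear_map_on_def fscale_apply)
qed

text \<open>
  Freezing one of the two variables in \<open>\<Sum> g(x) h(y) = f(x y)\<close> leaves a linear combination of elements of
  \<open>A\<close>.
\<close>

lemma translate_in:
  assumes "f \<in> A"
  shows "left_translate m f \<in> A" and "right_translate f m \<in> A"
proof -
  note t = comult_in[OF assms]
  have "left_translate m f = slice fscale A A (\<lambda>h. h m) (comult A f)"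
    by (simp add: fun_eq_iff left_translate_def comult_values[OF assms, symmetric] values_eq_slice[OF t])
  then show "left_translate m f \<in> A"
    by (simp add: AA.slice_in[OF linear_map_on_point t])
  have "(\<lambda>y. tensor_lift fscale fscale A A (\<lambda>g h. g m * h y) t) \<in> A"
    if "t \<in> tensor_space fscale fscale A A" for t
    using that
  proof (induction rule: AA.tensor_space_induct)
    case (pure g h)
    then show ?case
      using fscale.subspace_scale[OF AA.subspace_A pure(2), of "g m"]
      by (simp add: values_pure fscale_def[of "g m" h])
  next
    case (add t u)
    have "(\<lambda>y. tensor_lift fscale fscale A A (\<lambda>g h. g m * h y) (t + u)) =
        (\<lambda>y. tensor_lift fscale fscale A A (\<lambda>g h. g m * h y) t) +
        (\<lambda>y. tensor_lift fscale fscale A A (\<lambda>g h. g m * h y) u)"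
      by (rule ext, subst values_add[OF add(1,2)]) simp
    then show ?case
      using fscale.subspace_add[OF AA.subspace_A add(3,4)] by metis
  qed
  from this[OF t] show "right_translate f m \<in> A"
    by (simp add: comult_values[OF assms] right_translate_def)
qed

lemma linear_map_on_translates:
  "linear_map_on fscale fscale A (left_translate m)"
  "linear_map_on fscale fscale A (\<lambda>f. right_translate f m)"
  by (simp_all add: linear_map_on_def left_translate_def right_translate_def fscale_def fun_eq_iff)

lemma linear_map_on_mult: "linear_map_on fscale fscale A (\<lambda>f. h * f)"
  by (simp add: linear_map_on_def fscale_def fun_eq_iff algebra_simps)

lemma power_polynomial_character:
  assumes "polynomial_character A l"
  shows "polynomial_character A (l ^ s)"
proof (induction s)
  case 0
  then show ?case
    using subalgebra_A by (auto simp: polynomial_character_def subalgebra_def one_fun_def)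
next
  case (Suc s)
  then have "l ^ Suc s \<in> A"
    using assms unfolding power_Suc by (intro A_times) (simp_all add: polynomial_character_def)
  moreover have "(l ^ Suc s) (x * y) = (l ^ Suc s) x * (l ^ Suc s) y" "(l ^ Suc s) 1 = 1" for x y
    using Suc assms by (simp_all add: polynomial_character_def)
  ultimately show ?case by (simp only: polynomial_character_def) blast
qed

end

section \<open>Comodules as actions with regular matrix coefficients\<close>

lemma comodule_act_eq_slice:
  "comodule_act A sc \<chi> m = (\<lambda>v. slice sc UNIV A (\<lambda>f. f m) (\<chi> v))"
  by (simp add: fun_eq_iff comodule_act_def slice_def)

locale comodule_space = monoid_function_ring A + v: vector_space sc
  for A :: "('m::monoid_mult \<Rightarrow> 'k::field) set" and sc :: "'k \<Rightarrow> 'v::ab_group_add \<Rightarrow> 'v"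

sublocale comodule_space \<subseteq> VA: function_tensor sc UNIV A
  by unfold_locales (auto intro: AA.subspace_A)

sublocale comodule_space \<subseteq> VAA: function_tensor fscale "tensor_space sc fscale UNIV A" A
  by unfold_locales (auto intro: AA.subspace_A VA.subspace_tensor_space)

sublocale comodule_space \<subseteq> V_AA: function_tensor sc UNIV "tensor_space fscale fscale A A"
  by unfold_locales (auto intro: AA.subspace_tensor_space)

context comodule_space
begin

abbreviation VA_tensors where "VA_tensors \<equiv> tensor_space sc fscale UNIV A"

text \<open>
  Elements of \<open>(V \<otimes> A) \<otimes> A\<close>, where coassociativity is stated, are separated by their values at pairs
  of points: the outer factor is evaluated at \<open>y\<close>, then the inner one at \<open>x\<close>.
\<close>

abbreviation double_value where
  "double_value x y t \<equiv>
     slice sc UNIV A (\<lambda>f. f x) (slice fscale VA_tensors A (\<lambda>f. f y) t)"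

lemma linear_map_on_double_value:
  "linear_map_on fscale sc (tensor_space fscale fscale VA_tensors A) (double_value x y)"
  by (rule linear_map_on_compose[OF VAA.linear_map_on_slice[OF linear_map_on_point]
        VA.linear_map_on_slice[OF linear_map_on_point]])
    (rule VAA.slice_in[OF linear_map_on_point])

lemma double_value_inject:
  assumes "t \<in> tensor_space fscale fscale VA_tensors A" "u \<in> tensor_space fscale fscale VA_tensors A"
    and "\<And>x y. double_value x y t = double_value x y u"
  shows "t = u"
  by (intro VAA.slice_points_inject VA.slice_points_inject assms VAA.slice_in linear_map_on_point)

abbreviation assoc_at where
  "assoc_at v \<equiv> tensor_lift fscale fscale A A (\<lambda>f g. tensor fscale fscale (tensor sc fscale v f) g)"

lemma bilinear_assoc_at:
  "bilinear_on fscale fscale fscale A A (\<lambda>f g. tensor fscale fscale (tensor sc fscale v f) g)"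
  by (simp add: bilinear_on_def tensor_add_left tensor_add_right tensor_scale_left tensor_scale_right)

lemmas assoc_at_pure = AA.lift_pure[OF vector_space_fscale bilinear_assoc_at]
lemmas assoc_at_add = AA.lift_add[OF vector_space_fscale bilinear_assoc_at]
lemmas linear_map_on_assoc_at = AA.linear_map_on_lift[OF vector_space_fscale bilinear_assoc_at]

lemma assoc_at_in:
  "t \<in> tensor_space fscale fscale A A \<Longrightarrow> assoc_at v t \<in> tensor_space fscale fscale VA_tensors A"
  by (rule AA.lift_in[OF vector_space_fscale bilinear_assoc_at])
    (auto intro!: tensor_in_tensor_space tensor_space_add)

lemma double_value_assoc_at:
  assumes "t \<in> tensor_space fscale fscale A A"
  shows "double_value x y (assoc_at v t) =
    sc (tensor_lift fscale fscale A A (\<lambda>g h. g x * h y) t) v"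
  using assms
proof (induction rule: AA.tensor_space_induct)
  case (pure g h)
  then have "tensor sc fscale v g \<in> VA_tensors" by (auto intro: tensor_in_tensor_space)
  then show ?case
    using pure VA.linear_map_on_slice[OF linear_map_on_point[of A x]]
    by (simp add: assoc_at_pure values_pure VAA.slice_pure[OF linear_map_on_point]
        VA.slice_pure[OF linear_map_on_point] linear_map_on_def mult.commute)
next
  case (add t u)
  then show ?case
    using linear_map_on_double_value[of x y] assoc_at_in[of t v] assoc_at_in[of u v]
    by (simp add: assoc_at_add values_add linear_map_on_def v.scale_left_distrib del: plus_fun_apply)
qed

text \<open>
  Additivity and homogeneity in \<open>v\<close> concern maps that are built by \<open>tensor_lift\<close> separately for each
  \<open>v\<close>; comparing their values at pairs of points avoids relating these constructions directly.
\<close>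

lemma bilinear_assoc:
  "bilinear_on sc fscale fscale UNIV (tensor_space fscale fscale A A) assoc_at"
  unfolding bilinear_on_def
proof (intro conjI ballI allI)
  fix v v' c and t assume t: "t \<in> tensor_space fscale fscale A A"
  note in1 = assoc_at_in[OF t]
  note lin = linear_map_on_double_value[unfolded linear_map_on_def]
  show "assoc_at (v + v') t = assoc_at v t + assoc_at v' t"
    using in1 lin
    by (intro double_value_inject)
      (simp_all add: tensor_space_add double_value_assoc_at[OF t] v.scale_right_distrib
        del: plus_fun_apply)
  show "assoc_at (sc c v) t = fscale c (assoc_at v t)"
    using in1 lin fscale.subspace_scale[OF VAA.subspace_tensor_space in1]
    by (intro double_value_inject)
      (simp_all add: double_value_assoc_at[OF t] mult.commute)
next
  show "assoc_at v (t + u) = assoc_at v t + assoc_at v u"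
    if "t \<in> tensor_space fscale fscale A A" "u \<in> tensor_space fscale fscale A A" for v t u
    using that by (rule assoc_at_add)
  show "assoc_at v (fscale c t) = fscale c (assoc_at v t)"
    if "t \<in> tensor_space fscale fscale A A" for v t c
    using that linear_map_on_assoc_at by (simp add: linear_map_on_def)
qed

lemma tensor_assoc_in:
  "t \<in> tensor_space sc fscale UNIV (tensor_space fscale fscale A A) \<Longrightarrow>
   tensor_assoc sc A A t \<in> tensor_space fscale fscale VA_tensors A"
  unfolding tensor_assoc_def
  by (rule V_AA.lift_in[OF vector_space_fscale bilinear_assoc]) (auto intro: assoc_at_in tensor_space_add)

lemma double_value_tensor_assoc:
  assumes t: "t \<in> tensor_space sc fscale UNIV (tensor_space fscale fscale A A)"
  shows "double_value x y (tensor_assoc sc A A t) =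
    slice sc UNIV (tensor_space fscale fscale A A) (tensor_lift fscale fscale A A (\<lambda>g h. g x * h y)) t"
  using t
proof (rule V_AA.slice_unique[OF linear_map_on_values, rotated -1])
  show "linear_map_on fscale sc (tensor_space sc fscale UNIV (tensor_space fscale fscale A A))
      (\<lambda>t. double_value x y (tensor_assoc sc A A t))"
    by (rule linear_map_on_compose[OF _ linear_map_on_double_value tensor_assoc_in])
      (auto simp: tensor_assoc_def intro!: V_AA.linear_map_on_lift vector_space_fscale bilinear_assoc)
  show "double_value x y (tensor_assoc sc A A (tensor sc fscale v d)) =
      sc (tensor_lift fscale fscale A A (\<lambda>g h. g x * h y) d) v"
    if d: "d \<in> tensor_space fscale fscale A A" for v d
  proof -
    have "tensor_assoc sc A A (tensor sc fscale v d) = assoc_at v d"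
      unfolding tensor_assoc_def
      by (rule V_AA.lift_pure[OF vector_space_fscale bilinear_assoc _ d]) simp
    then show ?thesis using double_value_assoc_at[OF d] by simp
  qed
qed

text \<open>
  At the pair \<open>(x, y)\<close> the element \<open>\<Sum> \<chi>(v\<^sub>0) \<otimes> v\<^sub>1\<close> takes the value \<open>x \<cdot> (y \<cdot> v)\<close>, and the
  reassociated \<open>\<Sum> v\<^sub>0 \<otimes> \<Delta>(v\<^sub>1)\<close> takes the value \<open>\<Sum> v\<^sub>1(x y) v\<^sub>0 = (x y) \<cdot> v\<close>.
\<close>

lemma coassociative_iff_action:
  assumes lin: "Vector_Spaces.linear sc fscale \<chi>" and ran: "\<And>v. \<chi> v \<in> VA_tensors"
  shows "tensor_map sc fscale fscale fscale UNIV A \<chi> id (\<chi> v) =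
      tensor_assoc sc A A (tensor_map sc fscale sc fscale UNIV A id (comult A) (\<chi> v)) \<longleftrightarrow>
    (\<forall>x y. comodule_act A sc \<chi> x (comodule_act A sc \<chi> y v) = comodule_act A sc \<chi> (x * y) v)"
proof -
  let ?L = "tensor_map sc fscale fscale fscale UNIV A \<chi> id (\<chi> v)"
  let ?D = "tensor_map sc fscale sc fscale UNIV A id (comult A) (\<chi> v)"
  note lin' = linear_imp_linear_map_on[OF lin, of UNIV]
  note V_comult = V_AA.function_tensor_axioms linear_map_on_id[of sc UNIV] UNIV_I
    linear_map_on_comult comult_in
  note V_chi = VAA.function_tensor_axioms lin' ran linear_map_on_id[of fscale A]
  have L: "?L \<in> tensor_space fscale fscale VA_tensors A"
    by (rule VA.tensor_map_in[OF V_chi _ ran]) simp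
  have D: "?D \<in> tensor_space sc fscale UNIV (tensor_space fscale fscale A A)"
    by (rule VA.tensor_map_in[OF V_comult ran])
  have 1: "double_value x y ?L = comodule_act A sc \<chi> x (comodule_act A sc \<chi> y v)" for x y
    using VA.slice_tensor_map[OF V_chi _ linear_map_on_point ran, of y v]
    by (simp add: comodule_act_eq_slice)
  have "double_value x y (tensor_assoc sc A A ?D) =
      slice sc UNIV A (\<lambda>f. tensor_lift fscale fscale A A (\<lambda>g h. g x * h y) (comult A f)) (\<chi> v)" for x y
    using VA.slice_tensor_map[OF V_comult linear_map_on_values ran, of x y v]
    by (simp add: double_value_tensor_assoc[OF D])
  also have "\<dots> x y = comodule_act A sc \<chi> (x * y) v" for x y
    using VA.slice_proportional[OF linear_map_on_point[of A "x * y"]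
        linear_map_on_compose[OF linear_map_on_comult linear_map_on_values comult_in] _ ran, of 1 x y 1 v]
    by (simp add: comult_values comodule_act_eq_slice)
  finally have 2: "double_value x y (tensor_assoc sc A A ?D) = comodule_act A sc \<chi> (x * y) v" for x y .
  show ?thesis
    using double_value_inject[OF L tensor_assoc_in[OF D]] 1 2 by metis
qed

lemma comodule_iff_action:
  "comodule A sc \<chi> \<longleftrightarrow>
     Vector_Spaces.linear sc fscale \<chi> \<and> (\<forall>v. \<chi> v \<in> VA_tensors) \<and>
     (\<forall>v x y. comodule_act A sc \<chi> x (comodule_act A sc \<chi> y v) = comodule_act A sc \<chi> (x * y) v) \<and>
     (\<forall>v. comodule_act A sc \<chi> 1 v = v)"
  using coassociative_iff_action[of \<chi>]
  by (auto simp: comodule_def comodule_act_def counit_def)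

end

locale comodule_structure = comodule_space A sc
  for A :: "('m::monoid_mult \<Rightarrow> 'k::field) set" and sc :: "'k \<Rightarrow> 'v::ab_group_add \<Rightarrow> 'v" +
  fixes \<chi>
  assumes comodule: "comodule A sc \<chi>"
begin

abbreviation act where "act \<equiv> comodule_act A sc \<chi>"

lemma linear_coaction: "linear_map_on sc fscale S \<chi>"
  and coaction_in: "\<chi> v \<in> VA_tensors"
  and act_act: "act x (act y v) = act (x * y) v"
  and act_one: "act 1 v = v"
  using comodule by (auto simp: comodule_iff_action intro: linear_imp_linear_map_on)

lemma linear_slice_coaction:
  assumes "linear_map_on fscale (*) A L"
  shows "linear_map_on sc sc UNIV (\<lambda>v. slice sc UNIV A L (\<chi> v))"
  by (rule linear_map_on_compose[OF linear_coaction VA.linear_map_on_slice[OF assms] coaction_in])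

lemma linear_act: "linear_map_on sc sc UNIV (act m)"
  using linear_slice_coaction[OF linear_map_on_point] by (simp add: comodule_act_eq_slice)

text \<open>
  The law \<open>m \<cdot> (x \<cdot> v) = (m x) \<cdot> v\<close>, read as an identity of functions of \<open>x\<close>, says
  \<open>\<Sum> m \<cdot> v\<^sub>0 \<otimes> v\<^sub>1 = \<Sum> v\<^sub>0 \<otimes> v\<^sub>1 \<cdot> m\<close>; contracting both sides by \<open>L\<close> gives the claim.
\<close>

lemma act_slice:
  assumes L: "linear_map_on fscale (*) A L"
  shows "act m (slice sc UNIV A L (\<chi> v)) = slice sc UNIV A (\<lambda>f. L (right_translate f m)) (\<chi> v)"
proof -
  note V_act = VA.function_tensor_axioms linear_act[of m] UNIV_I linear_map_on_id[of fscale A]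
  note V_rt = VA.function_tensor_axioms linear_map_on_id[of sc UNIV] UNIV_I
    linear_map_on_translates(2)[of m] translate_in(2)
  have id_in: "id f \<in> A" if "f \<in> A" for f using that by simp
  have "tensor_map sc fscale sc fscale UNIV A (act m) id (\<chi> v) =
      tensor_map sc fscale sc fscale UNIV A id (\<lambda>f. right_translate f m) (\<chi> v)"
  proof (rule VA.slice_points_inject)
    fix x
    have "slice sc UNIV A (\<lambda>f. f x) (tensor_map sc fscale sc fscale UNIV A (act m) id (\<chi> v)) =
        act m (act x v)"
      using VA.slice_tensor_map[OF V_act id_in linear_map_on_point coaction_in, of x v]
      by (simp add: comodule_act_eq_slice id_def)
    also have "\<dots> = slice sc UNIV A (\<lambda>f. f x)
        (tensor_map sc fscale sc fscale UNIV A id (\<lambda>f. right_translate f m) (\<chi> v))"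
      using VA.slice_tensor_map[OF V_rt linear_map_on_point coaction_in, of x v]
      by (simp add: act_act comodule_act_eq_slice[of _ _ _ "m * x"] right_translate_apply)
    finally show "slice sc UNIV A (\<lambda>f. f x) (tensor_map sc fscale sc fscale UNIV A (act m) id (\<chi> v)) =
        slice sc UNIV A (\<lambda>f. f x)
          (tensor_map sc fscale sc fscale UNIV A id (\<lambda>f. right_translate f m) (\<chi> v))" .
  qed (rule VA.tensor_map_in[OF V_act id_in coaction_in] VA.tensor_map_in[OF V_rt coaction_in]
      | assumption)+
  then show ?thesis
    using VA.slice_tensor_map[OF V_act id_in L coaction_in, of v]
      VA.slice_tensor_map[OF V_rt L coaction_in, of v] by (simp add: id_def)
qed

text \<open>
  The law \<open>x \<cdot> (m \<cdot> v) = (x m) \<cdot> v\<close>, read as an identity of functions of \<open>x\<close>, says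
  \<open>\<chi>(m \<cdot> v) = \<Sum> v\<^sub>0 \<otimes> m \<cdot> v\<^sub>1\<close>.
\<close>

lemma slice_act:
  assumes L: "linear_map_on fscale (*) A L"
  shows "slice sc UNIV A L (\<chi> (act m v)) = slice sc UNIV A (\<lambda>f. L (left_translate m f)) (\<chi> v)"
proof -
  note V_lt = VA.function_tensor_axioms linear_map_on_id[of sc UNIV] UNIV_I
    linear_map_on_translates(1)[of m] translate_in(1)
  have "\<chi> (act m v) = tensor_map sc fscale sc fscale UNIV A id (left_translate m) (\<chi> v)"
  proof (rule VA.slice_points_inject)
    fix x
    show "slice sc UNIV A (\<lambda>f. f x) (\<chi> (act m v)) = slice sc UNIV A (\<lambda>f. f x)
        (tensor_map sc fscale sc fscale UNIV A id (left_translate m) (\<chi> v))"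
      using VA.slice_tensor_map[OF V_lt linear_map_on_point coaction_in, of x v] act_act[of x m v]
      by (simp add: comodule_act_eq_slice left_translate_apply)
  qed (rule coaction_in VA.tensor_map_in[OF V_lt coaction_in])+
  then show ?thesis
    using VA.slice_tensor_map[OF V_lt L coaction_in, of v] by simp
qed

context
  fixes h assumes h: "h \<in> A"
begin

lemmas mult_second_facts = VA.function_tensor_axioms linear_map_on_id[of sc UNIV] UNIV_I
  linear_map_on_mult A_times[OF h]

lemma mult_second_in: "t \<in> VA_tensors \<Longrightarrow> mult_second A sc h t \<in> VA_tensors"
  unfolding mult_second_def by (rule VA.tensor_map_in[OF mult_second_facts])

lemma slice_mult_second:
  assumes t: "t \<in> VA_tensors"
  shows "slice sc UNIV A (\<lambda>f. f m) (mult_second A sc h t) = sc (h m) (slice sc UNIV A (\<lambda>f. f m) t)"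
proof -
  have "linear_map_on fscale (*) A (\<lambda>f. (h * f) m)"
    by (simp add: linear_map_on_def fscale_def algebra_simps)
  from VA.slice_proportional[OF linear_map_on_point[of A m] this _ t, of 1 "h m"]
  show ?thesis
    using VA.slice_tensor_map[OF mult_second_facts linear_map_on_point t, of m]
    by (simp add: mult_second_def)
qed

lemma twisted_act:
  "comodule_act A sc (\<lambda>v. mult_second A sc h (\<chi> v)) m v = sc (h m) (act m v)"
  by (simp add: comodule_act_eq_slice slice_mult_second coaction_in)

text \<open>
  By \<open>twisted_act\<close> the twist is the action \<open>(m, v) \<mapsto> h(m) m \<cdot> v\<close>, which is associative and unital
  because \<open>h\<close> and the original action are.
\<close>

lemma comodule_twist:
  assumes mult: "\<And>x y. h (x * y) = h x * h y" and one: "h 1 = 1"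
  shows "comodule A sc (\<lambda>v. mult_second A sc h (\<chi> v))"
proof -
  have "linear_map_on sc fscale UNIV (\<lambda>v. mult_second A sc h (\<chi> v))"
    unfolding mult_second_def
    by (rule linear_map_on_compose[OF linear_coaction
          VA.linear_map_on_tensor_map[OF mult_second_facts] coaction_in])
  then have "Vector_Spaces.linear sc fscale (\<lambda>v. mult_second A sc h (\<chi> v))"
    by (simp add: linear_map_on_def Vector_Spaces.linear_iff v.vector_space_axioms vector_space_fscale)
  moreover have "sc (h x) (act x (sc (h y) (act y v))) = sc (h (x * y)) (act (x * y) v)" for x y v
    using linear_act[of x] mult act_act[of x y v] by (simp add: linear_map_on_def)
  ultimately show ?thesis
    by (simp add: comodule_iff_action twisted_act mult_second_in coaction_in act_one one)
qed

end

end

lemma restrict_units_in: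
  assumes "subalgebra A" "f \<in> A"
  shows "restrict_units f \<in> unit_group_ring A"
  unfolding unit_group_ring_def restrict_units_def
  using assms
  by (intro CollectI allI, rule_tac bexI[of _ f], rule_tac bexI[of _ "\<lambda>_. 1"])
    (simp_all add: subalgebra_def)

text \<open>
  The action of the unit group is defined by contraction over \<open>unit_group_ring A\<close>. Contractions are
  well defined over subspaces, so this ring has to be shown to be one before the action can be
  identified with the restriction of the action of the monoid.
\<close>

lemma subspace_unit_group_ring:
  assumes A: "subalgebra A"
  shows "fscale.subspace (unit_group_ring A)"
proof (rule fscale.subspaceI)
  have const: "(\<lambda>_. c) \<in> A" and add: "f \<in> A \<Longrightarrow> g \<in> A \<Longrightarrow> f + g \<in> A"
    and mult: "f \<in> A \<Longrightarrow> g \<in> A \<Longrightarrow> f * g \<in> A" for c f g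
    using A by (auto simp: subalgebra_def)
  have const': "(\<lambda>_. c) \<in> unit_group_ring A" for c
    using restrict_units_in[OF A const[of c]] by (simp add: restrict_units_def comp_def)
  show "0 \<in> unit_group_ring A" using const'[of 0] by (simp add: zero_fun_def)
  show "f + g \<in> unit_group_ring A" if f: "f \<in> unit_group_ring A" and g: "g \<in> unit_group_ring A" for f g
    unfolding unit_group_ring_def
  proof (intro CollectI allI)
    fix x
    obtain p q where pq: "p \<in> A" "q \<in> A" "q (Rep_unit_group x) \<noteq> 0"
      "\<forall>y. q (Rep_unit_group y) \<noteq> 0 \<longrightarrow> f y = p (Rep_unit_group y) / q (Rep_unit_group y)"
      using f unfolding unit_group_ring_def by blast
    obtain p' q' where pq': "p' \<in> A" "q' \<in> A" "q' (Rep_unit_group x) \<noteq> 0"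
      "\<forall>y. q' (Rep_unit_group y) \<noteq> 0 \<longrightarrow> g y = p' (Rep_unit_group y) / q' (Rep_unit_group y)"
      using g unfolding unit_group_ring_def by blast
    show "\<exists>p\<in>A. \<exists>q\<in>A. q (Rep_unit_group x) \<noteq> 0 \<and>
        (\<forall>y. q (Rep_unit_group y) \<noteq> 0 \<longrightarrow> (f + g) y = p (Rep_unit_group y) / q (Rep_unit_group y))"
      by (rule bexI[of _ "p * q' + p' * q"], rule bexI[of _ "q * q'"])
        (use pq pq' in \<open>auto intro!: add mult simp: add_frac_eq\<close>)
  qed
  show "fscale c f \<in> unit_group_ring A" if f: "f \<in> unit_group_ring A" for c f
    unfolding unit_group_ring_def
  proof (intro CollectI allI)
    fix x
    obtain p q where pq: "p \<in> A" "q \<in> A" "q (Rep_unit_group x) \<noteq> 0"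
      "\<forall>y. q (Rep_unit_group y) \<noteq> 0 \<longrightarrow> f y = p (Rep_unit_group y) / q (Rep_unit_group y)"
      using f unfolding unit_group_ring_def by blast
    show "\<exists>p\<in>A. \<exists>q\<in>A. q (Rep_unit_group x) \<noteq> 0 \<and>
        (\<forall>y. q (Rep_unit_group y) \<noteq> 0 \<longrightarrow> fscale c f y = p (Rep_unit_group y) / q (Rep_unit_group y))"
      by (rule bexI[of _ "(\<lambda>_. c) * p"], rule bexI[of _ q])
        (use pq in \<open>auto intro!: const mult simp: fscale_def\<close>)
  qed
qed

lemma (in comodule_structure) polynomial_unit_module_act:
  assumes "polynomial_unit_module A sc \<theta> \<chi>"
  shows "comodule_act (unit_group_ring A) sc \<theta> g v = act (Rep_unit_group g) v"
proof -
  have \<theta>: "\<theta> v = tensor_map sc fscale sc fscale UNIV A id restrict_units (\<chi> v)"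
    using assms by (simp add: polynomial_unit_module_def)
  have target: "function_tensor sc UNIV (unit_group_ring A)"
    by unfold_locales (auto intro: subspace_unit_group_ring subalgebra_A)
  have lin: "linear_map_on fscale fscale A restrict_units"
    by (simp add: linear_map_on_def restrict_units_def fscale_def fun_eq_iff)
  show ?thesis
    unfolding comodule_act_eq_slice
    using VA.slice_tensor_map[OF target linear_map_on_id UNIV_I lin restrict_units_in[OF subalgebra_A]
        linear_map_on_point coaction_in, of g v]
    by (simp add: \<theta> restrict_units_apply)
qed

section \<open>The map defined by an Omega process\<close>

context monoid_function_ring
begin

context
  fixes l \<Omega> assumes \<Omega>: "omega_process A l \<Omega>"
begin

lemma linear_map_on_omega: "linear_map_on fscale fscale A \<Omega>"
  using \<Omega> by (simp add: omega_process_def linear_map_on_def)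

lemma omega_power_in: "f \<in> A \<Longrightarrow> (\<Omega> ^^ r) f \<in> A"
  using \<Omega> by (induction r) (auto simp: omega_process_def)

lemma linear_map_on_omega_power: "linear_map_on fscale fscale A (\<Omega> ^^ r)"
proof (induction r)
  case 0
  then show ?case by (simp add: linear_map_on_def)
next
  case (Suc r)
  show ?case
    using linear_map_on_compose[OF Suc linear_map_on_omega omega_power_in] by (simp add: comp_def)
qed

lemma omega_power_translate:
  assumes "f \<in> A"
  shows "(\<Omega> ^^ r) (left_translate m f) = fscale (l m ^ r) (left_translate m ((\<Omega> ^^ r) f))"
    and "(\<Omega> ^^ r) (right_translate f m) = fscale (l m ^ r) (right_translate ((\<Omega> ^^ r) f) m)"
proof (induction r)
  case (Suc r)
  note in_A = omega_power_in[OF assms, of r]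
  {
    case 1
    show ?case
      using Suc(1) \<Omega> translate_in(1)[OF in_A, of m] in_A by (simp add: omega_process_def mult.commute)
  next
    case 2
    show ?case
      using Suc(2) \<Omega> translate_in(2)[OF in_A, of m] in_A by (simp add: omega_process_def mult.commute)
  }
qed simp_all

end

end

locale omega_setting = comodule_structure A sc \<chi>
  for A :: "('m::{monoid_mult,mult_zero} \<Rightarrow> 'k::field) set"
    and sc :: "'k \<Rightarrow> 'v::ab_group_add \<Rightarrow> 'v" and \<chi> +
  fixes l \<Omega> and r s :: nat
  assumes character: "polynomial_character A l" and omega: "omega_process A l \<Omega>"
begin

text \<open>The functional \<open>L\<close> whose contraction is the map \<open>I\<close>.\<close>

abbreviation weight_functional where "weight_functional f \<equiv> (\<Omega> ^^ r) (l ^ s * f) 0"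

lemma power_in: "l ^ n \<in> A"
  using power_polynomial_character[OF character] by (simp add: polynomial_character_def)

lemma power_apply: "(l ^ n) m = l m ^ n"
  by (induction n) auto

lemma linear_weight_functional: "linear_map_on fscale (*) A weight_functional"
proof -
  have "linear_map_on fscale fscale A (\<lambda>f. (\<Omega> ^^ r) (l ^ s * f))"
    by (rule linear_map_on_compose[OF linear_map_on_mult linear_map_on_omega_power[OF omega]
          A_times[OF power_in]])
  from linear_map_on_compose[OF this linear_map_on_point[of UNIV]] show ?thesis by simp
qed

text \<open>
  The factor \<open>\<lambda>(m)\<^sup>s\<close> turns \<open>\<lambda>\<^sup>s\<close> times a translate of \<open>f\<close> into the translate of \<open>\<lambda>\<^sup>s f\<close>. Then
  \<open>\<Omega>\<^sup>r\<close> commutes with the translation up to \<open>\<lambda>(m)\<^sup>r\<close>, and a translate has the same value at \<open>0\<close> as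
  the function itself because \<open>0 m = 0 = m 0\<close>.
\<close>

lemma weight_functional_translate:
  assumes f: "f \<in> A"
  shows "l m ^ s * weight_functional (left_translate m f) = l m ^ r * weight_functional f"
    and "l m ^ s * weight_functional (right_translate f m) = l m ^ r * weight_functional f"
proof -
  have lin: "(\<Omega> ^^ r) (fscale c g) = fscale c ((\<Omega> ^^ r) g)" if "g \<in> A" for c g
    using linear_map_on_omega_power[OF omega] that by (simp add: linear_map_on_def)
  note in_A = A_times[OF power_in[of s]]
  have l: "l (x * y) = l x * l y" for x y
    using character by (simp add: polynomial_character_def)
  have "fscale (l m ^ s) (l ^ s * left_translate m f) = left_translate m (l ^ s * f)"
    by (simp add: fun_eq_iff fscale_def left_translate_def power_apply l power_mult_distrib)
  then have "l m ^ s * weight_functional (left_translate m f) = (\<Omega> ^^ r) (left_translate m (l ^ s * f)) 0"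
    using lin[OF in_A[OF translate_in(1)[OF f]]] by (metis fscale_def)
  then show "l m ^ s * weight_functional (left_translate m f) = l m ^ r * weight_functional f"
    by (simp add: omega_power_translate(1)[OF omega in_A[OF f]] fscale_apply left_translate_apply)
  have "fscale (l m ^ s) (l ^ s * right_translate f m) = right_translate (l ^ s * f) m"
    by (simp add: fun_eq_iff fscale_def right_translate_def power_apply l power_mult_distrib)
  then have "l m ^ s * weight_functional (right_translate f m) = (\<Omega> ^^ r) (right_translate (l ^ s * f) m) 0"
    using lin[OF in_A[OF translate_in(2)[OF f]]] by (metis fscale_def)
  then show "l m ^ s * weight_functional (right_translate f m) = l m ^ r * weight_functional f"
    by (simp add: omega_power_translate(2)[OF omega in_A[OF f]] fscale_apply right_translate_apply)
qed

abbreviation I where "I \<equiv> omega_map A sc \<chi> l \<Omega> r s"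
abbreviation twist where "twist \<equiv> \<lambda>v. mult_second A sc (l ^ s) (\<chi> v)"

lemma omega_map_eq_slice: "I = (\<lambda>v. slice sc UNIV A weight_functional (\<chi> v))"
  by (simp add: fun_eq_iff omega_map_def slice_def)

lemma linear_omega_map: "linear_map_on sc sc UNIV I"
  using linear_slice_coaction[OF linear_weight_functional] by (simp add: omega_map_eq_slice)

lemma linear_weight_functional_translate:
  "linear_map_on fscale (*) A (\<lambda>f. weight_functional (left_translate m f))"
  "linear_map_on fscale (*) A (\<lambda>f. weight_functional (right_translate f m))"
  by (rule linear_map_on_compose[OF _ linear_weight_functional],
      auto intro: linear_map_on_translates translate_in)+

lemma act_omega_map: "sc (l m ^ s) (act m (I v)) = sc (l m ^ r) (I v)"
  unfolding omega_map_eq_slice act_slice[OF linear_weight_functional]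
  by (rule VA.slice_proportional[OF linear_weight_functional linear_weight_functional_translate(2)
        weight_functional_translate(2) coaction_in])

lemma omega_map_act: "sc (l m ^ s) (I (act m v)) = sc (l m ^ r) (I v)"
  unfolding omega_map_eq_slice slice_act[OF linear_weight_functional]
  by (rule VA.slice_proportional[OF linear_weight_functional linear_weight_functional_translate(1)
        weight_functional_translate(1) coaction_in])

lemma slice_twist: "slice sc UNIV A (\<lambda>f. f m) (twist v) = sc (l m ^ s) (act m v)"
  using twisted_act[OF power_in] by (simp add: comodule_act_eq_slice power_apply)

lemma twist_in: "twist v \<in> VA_tensors"
  by (rule mult_second_in[OF power_in coaction_in])

lemma comodule_morphism_omega_map: "comodule_morphism A sc twist sc twist I"
proof -
  note V_I = VA.function_tensor_axioms linear_omega_map UNIV_I linear_map_on_id[of fscale A]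
  have id_in: "id f \<in> A" if "f \<in> A" for f using that by simp
  have "twist (I v) = tensor_map sc fscale sc fscale UNIV A I id (twist v)" for v
  proof (rule VA.slice_points_inject)
    fix m
    have "slice sc UNIV A (\<lambda>f. f m) (tensor_map sc fscale sc fscale UNIV A I id (twist v)) =
        I (sc (l m ^ s) (act m v))"
      using VA.slice_tensor_map[OF V_I id_in linear_map_on_point twist_in, of m v]
      by (simp add: slice_twist id_def)
    also have "\<dots> = sc (l m ^ s) (I (act m v))"
      using linear_omega_map by (simp add: linear_map_on_def)
    also have "\<dots> = slice sc UNIV A (\<lambda>f. f m) (twist (I v))"
      by (simp add: slice_twist act_omega_map omega_map_act)
    finally show "slice sc UNIV A (\<lambda>f. f m) (twist (I v)) =
        slice sc UNIV A (\<lambda>f. f m) (tensor_map sc fscale sc fscale UNIV A I id (twist v))" ..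
  qed (rule twist_in VA.tensor_map_in[OF V_I id_in twist_in])+
  moreover have "Vector_Spaces.linear sc sc I"
    using linear_omega_map by (simp add: linear_map_on_def Vector_Spaces.linear_iff v.vector_space_axioms)
  ultimately show ?thesis
    using comodule_twist[OF power_in[of s]] power_polynomial_character[OF character, of s]
    by (simp add: comodule_morphism_def polynomial_character_def fun_eq_iff comp_def)
qed

lemma twist_omega_map: "twist (I v) = mult_second A sc (l ^ r) (tensor sc fscale (I v) 1)"
proof (rule VA.slice_points_inject)
  have one: "1 \<in> A"
    using power_in[of 0] by simp
  then have pure: "tensor sc fscale (I v) 1 \<in> VA_tensors"
    by (intro tensor_in_tensor_space) auto
  then show "mult_second A sc (l ^ r) (tensor sc fscale (I v) 1) \<in> VA_tensors"
    by (rule mult_second_in[OF power_in])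
  show "slice sc UNIV A (\<lambda>f. f m) (twist (I v)) =
      slice sc UNIV A (\<lambda>f. f m) (mult_second A sc (l ^ r) (tensor sc fscale (I v) 1))" for m
    by (simp add: slice_twist act_omega_map slice_mult_second[OF power_in pure]
        VA.slice_pure[OF linear_map_on_point _ one] power_apply)
qed (rule twist_in)

lemma character_unit_nonzero: "l (Rep_unit_group g) \<noteq> 0"
proof -
  obtain n where "Rep_unit_group g * n = 1" using Rep_unit_group[of g] by auto
  then have "l (Rep_unit_group g) * l n = 1"
    using character by (metis polynomial_character_def)
  then show ?thesis by auto
qed

text \<open>
  This is \<open>act_omega_map\<close> divided by \<open>\<lambda>(g)\<^sup>s\<close>, which is nonzero as \<open>g\<close> is invertible.
\<close>

lemma unit_act_omega_map:
  "act (Rep_unit_group g) (I v) = sc (l (Rep_unit_group g) powi (int r - int s)) (I v)"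
proof -
  let ?c = "l (Rep_unit_group g)"
  have "sc (inverse (?c ^ s)) (sc (?c ^ s) (act (Rep_unit_group g) (I v))) =
      sc (inverse (?c ^ s)) (sc (?c ^ r) (I v))"
    by (simp only: act_omega_map)
  then show ?thesis
    using character_unit_nonzero[of g] by (simp add: power_int_diff divide_inverse mult.commute)
qed

end

theorem theorem9:
  fixes A :: "('m::{monoid_mult,mult_zero} \<Rightarrow> 'k::{alg_closed_field,field_char_0}) set"
    and l :: "'m \<Rightarrow> 'k"
    and \<Omega> :: "('m \<Rightarrow> 'k) \<Rightarrow> ('m \<Rightarrow> 'k)"
    and sc :: "'k \<Rightarrow> 'v::ab_group_add \<Rightarrow> 'v"
    and \<chi> :: "'v \<Rightarrow> (('v \<Rightarrow> ('m \<Rightarrow> 'k) \<Rightarrow> 'k) \<Rightarrow> 'k)"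
    and r s :: nat
  assumes "affine_algebraic_monoid A"
    and "polynomial_character A l" and "\<exists>m. l m \<noteq> 1"
    and "omega_process A l \<Omega>"
    and "vector_space sc" and "comodule A sc \<chi>"
  shows "let
      I = omega_map A sc \<chi> l \<Omega> r s;
      twist = (\<lambda>v. mult_second A sc (l ^ s) (\<chi> v))
    in
      comodule_morphism A sc twist sc twist I \<and>
      (\<forall>v. twist (I v) = mult_second A sc (l ^ r) (tensor sc fscale (I v) 1)) \<and>
      (\<forall>\<theta>. polynomial_unit_module A sc \<theta> \<chi> \<longrightarrow>
        (\<forall>v g. comodule_act (unit_group_ring A) sc \<theta> g (I v) =
               sc (l (Rep_unit_group g) powi (int r - int s)) (I v)))"
proof -
  interpret monoid_function_ring A
    by (rule affine_algebraic_monoid_function_ring) fact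
  interpret vector_space sc by fact
  interpret omega_setting A sc \<chi> l \<Omega> r s
    by unfold_locales fact+
  show ?thesis
    unfolding Let_def
    using comodule_morphism_omega_map twist_omega_map
    by (auto simp: polynomial_unit_module_act unit_act_omega_map)
qed

end
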